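(* Let $r\ge2$ and let $F_1,\ldots,F_r$ be $k$-uniform hypergraphs such that $m_k(F_1)\ge m_k(F_2)\ge\cdots\ge m_k(F_r)>0$. Then there exists a constant $C>0$ such that for $p\ge Cn^{-1/m_k(F_1,F_2)}\log n$, $$\lim_{n\to\infty}\Pr[H^k(n,p)\rightarrow(F_1,\ldots,F_r)]=1.$$
   Context: $H^k(n,p)$: random $k$-uniform hypergraph on $n$ vertices, each $k$-set an edge independently with probability $p$. $G\rightarrow(F_1,\ldots,F_r)$: every colouring of $E(G)$ with colours $1,\ldots,r$ has, for some $i$, a copy of $F_i$ all of whose edges have colour $i$. $d_k(G)=0$ if $e(G)=0$, $=1/k$ if $e(G)=1,v(G)=k$, else $\frac{e(G)-1}{v(G)-k}$; $m_k(G)=\max_{H\subseteq G}d_k(H)$. $m_k(F_1,F_2)=\max\{\frac{e(F_1')}{v(F_1')-k+1/m_k(F_2)}:F_1'\subseteq F_1,e(F_1')\ge1\}$. *)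

theory Defs
  imports "HOL-Probability.Probability"
begin

datatype 'a hypergraph = Hypergraph (verts: "'a set") (edges: "'a set set")

definition uniform_hypergraph :: "nat \<Rightarrow> 'a hypergraph \<Rightarrow> bool" where
  "uniform_hypergraph k G \<longleftrightarrow>
     finite (verts G) \<and> (\<forall>e\<in>edges G. e \<subseteq> verts G \<and> card e = k)"

text \<open>Subhypergraphs need not be induced, and may contain isolated vertices.\<close>

definition subhypergraph :: "'a hypergraph \<Rightarrow> 'a hypergraph \<Rightarrow> bool" where
  "subhypergraph H G \<longleftrightarrow>
     verts H \<subseteq> verts G \<and> edges H \<subseteq> edges G \<and> (\<forall>e\<in>edges H. e \<subseteq> verts H)"

definition isomorphic :: "'a hypergraph \<Rightarrow> 'b hypergraph \<Rightarrow> bool" where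
  "isomorphic F H \<longleftrightarrow>
     (\<exists>\<phi>. bij_betw \<phi> (verts F) (verts H) \<and> edges H = (\<lambda>e. \<phi> ` e) ` edges F)"

definition k_density :: "nat \<Rightarrow> 'a hypergraph \<Rightarrow> real" where
  "k_density k G =
     (if card (edges G) = 0 then 0
      else if card (edges G) = 1 \<and> card (verts G) = k then 1 / real k
      else (real (card (edges G)) - 1) / (real (card (verts G)) - real k))"

definition max_k_density :: "nat \<Rightarrow> 'a hypergraph \<Rightarrow> real" where
  "max_k_density k G = Max {k_density k H | H. subhypergraph H G}"

definition asym_k_density :: "nat \<Rightarrow> 'a hypergraph \<Rightarrow> 'b hypergraph \<Rightarrow> real" where
  "asym_k_density k F1 F2 =
     Max {real (card (edges H)) / (real (card (verts H)) - real k + 1 / max_k_density k F2) | H.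
            subhypergraph H F1 \<and> card (edges H) \<ge> 1}"

definition arrows :: "'v hypergraph \<Rightarrow> nat \<Rightarrow> (nat \<Rightarrow> 'a hypergraph) \<Rightarrow> bool" where
  "arrows G r F \<longleftrightarrow>
     (\<forall>c :: 'v set \<Rightarrow> nat. (\<forall>e\<in>edges G. c e \<in> {1..r}) \<longrightarrow>
        (\<exists>i\<in>{1..r}. \<exists>H. subhypergraph H G \<and> isomorphic (F i) H \<and> (\<forall>e\<in>edges H. c e = i)))"

definition k_sets :: "nat \<Rightarrow> nat \<Rightarrow> nat set set" where
  "k_sets k n = {e. e \<subseteq> {1..n} \<and> card e = k}"

text \<open>The binomial random hypergraph \<open>H\<^sup>k(n,p)\<close>: one independent Bernoulli variable per
  \<open>k\<close>-subset of \<open>{1..n}\<close>, deciding whether that subset is an edge.\<close>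

definition binomial_hypergraph :: "nat \<Rightarrow> nat \<Rightarrow> real \<Rightarrow> nat hypergraph pmf" where
  "binomial_hypergraph k n p =
     map_pmf (\<lambda>X. Hypergraph {1..n} {e \<in> k_sets k n. X e})
       (Pi_pmf (k_sets k n) False (\<lambda>_. bernoulli_pmf p))"

end

theory Submission imports Defs "HOL-Library.Ramsey" begin

text \<open>In a bad colouring, each colour class \<open>i \<ge> 2\<close> is \<open>F i\<close>-free, hence lies in one of
  \<open>exp (O(n\<^bsup>k - 1/m\<^esup> log n))\<close> containers with few copies of \<open>F i\<close>, where \<open>m\<close> is the density of
  \<open>F 2\<close>. By Ramsey's theorem and averaging, the \<open>k\<close>-sets outside the chosen containers span a
  positive proportion of all copies of \<open>F 1\<close>, and the random hypergraph must avoid all of them.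
  Janson's inequality bounds the probability of this by \<open>exp (- c C n\<^bsup>k - 1/m\<^esup> log n)\<close>, because the
  asymmetric density is exactly what makes every subgraph of \<open>F 1\<close> have at least
  \<open>C n\<^bsup>k - 1/m\<^esup> log n\<close> expected copies. A union bound over the containers finishes the proof; the
  logarithm in \<open>p\<close> pays for counting them without regard to \<open>p\<close>.\<close>

section \<open>Containers for tuple systems\<close>

definition has_containers :: "('v set \<Rightarrow> bool) \<Rightarrow> ('v set \<Rightarrow> bool) \<Rightarrow> real \<Rightarrow> bool" where
  "has_containers P Q M \<longleftrightarrow>
     (\<exists>\<C>. finite \<C> \<and> real (card \<C>) \<le> M \<and> (\<forall>C\<in>\<C>. Q C) \<and> (\<forall>I. P I \<longrightarrow> (\<exists>C\<in>\<C>. I \<subseteq> C)))"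

lemma has_containersI:
  assumes "finite \<C>" "real (card \<C>) \<le> M" "\<And>C. C \<in> \<C> \<Longrightarrow> Q C" "\<And>I. P I \<Longrightarrow> \<exists>C\<in>\<C>. I \<subseteq> C"
  shows "has_containers P Q M"
  unfolding has_containers_def using assms by blast

lemma has_containersE:
  assumes "has_containers P Q M"
  obtains \<C> where "finite \<C>" "real (card \<C>) \<le> M" "\<And>C. C \<in> \<C> \<Longrightarrow> Q C"
    "\<And>I. P I \<Longrightarrow> \<exists>C\<in>\<C>. I \<subseteq> C"
  using assms unfolding has_containers_def by blast

lemma has_containers_mono:
  assumes "has_containers P Q M" "\<And>I. P' I \<Longrightarrow> P I" "\<And>C. Q C \<Longrightarrow> Q' C" "M \<le> M'"
  shows "has_containers P' Q' M'"
  using assms(1)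
proof (rule has_containersE)
  fix \<C>
  assume "finite \<C>" "real (card \<C>) \<le> M" "\<And>C. C \<in> \<C> \<Longrightarrow> Q C" "\<And>I. P I \<Longrightarrow> \<exists>C\<in>\<C>. I \<subseteq> C"
  then show ?thesis using assms(2-4) by (intro has_containersI[of \<C>]) auto
qed

lemma has_containers_none:
  assumes "\<And>I. \<not> P I" "0 \<le> M"
  shows "has_containers P Q M"
  using assms by (intro has_containersI[of "{}"]) auto

lemma has_containers_single:
  assumes "Q C" "\<And>I. P I \<Longrightarrow> I \<subseteq> C" "1 \<le> M"
  shows "has_containers P Q M"
  using assms by (intro has_containersI[of "{C}"]) auto

lemma has_containers_disj:
  assumes "has_containers P Q M" "has_containers P' Q M'"
  shows "has_containers (\<lambda>I. P I \<or> P' I) Q (M + M')"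
proof -
  obtain \<C> where family: "finite \<C>" "real (card \<C>) \<le> M" "\<And>C. C \<in> \<C> \<Longrightarrow> Q C" "\<And>I. P I \<Longrightarrow> \<exists>C\<in>\<C>. I \<subseteq> C"
    using assms(1) by (rule has_containersE) (rule that)
  obtain \<D> where family': "finite \<D>" "real (card \<D>) \<le> M'" "\<And>C. C \<in> \<D> \<Longrightarrow> Q C" "\<And>I. P' I \<Longrightarrow> \<exists>C\<in>\<D>. I \<subseteq> C"
    using assms(2) by (rule has_containersE) (rule that)
  show ?thesis
  proof (rule has_containersI)
    show "finite (\<C> \<union> \<D>)" using family(1) family'(1) by simp
    show "real (card (\<C> \<union> \<D>)) \<le> M + M'" using card_Un_le[of \<C> \<D>] family(2) family'(2) by linarith
    show "Q C" if "C \<in> \<C> \<union> \<D>" for C using that family(3) family'(3) by blast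
    show "\<exists>C\<in>\<C> \<union> \<D>. I \<subseteq> C" if "P I \<or> P' I" for I using that family(4) family'(4) by (meson UnCI)
  qed
qed

lemma has_containers_bex:
  assumes "finite S" "\<And>s. s \<in> S \<Longrightarrow> has_containers (P s) Q M"
  shows "has_containers (\<lambda>I. \<exists>s\<in>S. P s I) Q (real (card S) * M)"
  using assms
proof (induction S)
  case empty
  then show ?case by (simp add: has_containers_none)
next
  case (insert s S)
  then have "has_containers (\<lambda>I. P s I \<or> (\<exists>t\<in>S. P t I)) Q (M + real (card S) * M)"
    by (intro has_containers_disj) auto
  then show ?case
    using insert.hyps by (simp add: distrib_right)
qed

lemma has_containers_refine:
  assumes "has_containers P Q M" "\<And>C. Q C \<Longrightarrow> has_containers (\<lambda>I. I \<subseteq> C \<and> P I) R M'" "0 \<le> M'"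
  shows "has_containers P R (M * M')"
proof -
  obtain \<C> where family: "finite \<C>" "real (card \<C>) \<le> M" "\<And>C. C \<in> \<C> \<Longrightarrow> Q C" "\<And>I. P I \<Longrightarrow> \<exists>C\<in>\<C>. I \<subseteq> C"
    using assms(1) by (rule has_containersE) (rule that)
  have "has_containers (\<lambda>I. \<exists>C\<in>\<C>. I \<subseteq> C \<and> P I) R (real (card \<C>) * M')"
    by (intro has_containers_bex assms(2) family(1,3))
  then show ?thesis
    by (rule has_containers_mono) (use family(2,4) assms(3) mult_right_mono in auto)
qed

lemma has_containers_UN:
  assumes "finite S" "\<And>s. s \<in> S \<Longrightarrow> has_containers (P s) (Q s) (M s)"
  shows "has_containers (\<lambda>I. \<exists>J. (\<forall>s\<in>S. P s (J s)) \<and> I = (\<Union>s\<in>S. J s))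
    (\<lambda>C. \<exists>D. (\<forall>s\<in>S. Q s (D s)) \<and> C = (\<Union>s\<in>S. D s)) (\<Prod>s\<in>S. M s)"
proof -
  have "\<forall>s\<in>S. \<exists>\<C>. finite \<C> \<and> real (card \<C>) \<le> M s \<and> (\<forall>C\<in>\<C>. Q s C) \<and> (\<forall>I. P s I \<longrightarrow> (\<exists>C\<in>\<C>. I \<subseteq> C))"
    using assms(2) unfolding has_containers_def by blast
  from bchoice[OF this] obtain \<C> where families: "\<And>s. s \<in> S \<Longrightarrow> finite (\<C> s)"
    "\<And>s. s \<in> S \<Longrightarrow> real (card (\<C> s)) \<le> M s" "\<And>s C. s \<in> S \<Longrightarrow> C \<in> \<C> s \<Longrightarrow> Q s C"
    "\<And>s I. s \<in> S \<Longrightarrow> P s I \<Longrightarrow> \<exists>C\<in>\<C> s. I \<subseteq> C"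
    by blast
  let ?U = "\<lambda>D. \<Union>s\<in>S. D s"
  have finite_choices: "finite (PiE S \<C>)" using assms(1) families(1) by (rule finite_PiE)
  show ?thesis
  proof (rule has_containersI[of "?U ` PiE S \<C>"])
    show "finite (?U ` PiE S \<C>)" using finite_choices by simp
    have "real (card (?U ` PiE S \<C>)) \<le> real (card (PiE S \<C>))"
      using card_image_le[OF finite_choices] by simp
    also have "\<dots> = (\<Prod>s\<in>S. real (card (\<C> s)))" using assms(1) by (simp add: card_PiE)
    also have "\<dots> \<le> (\<Prod>s\<in>S. M s)" using families(2) by (intro prod_mono) auto
    finally show "real (card (?U ` PiE S \<C>)) \<le> (\<Prod>s\<in>S. M s)" .
    show "\<exists>D. (\<forall>s\<in>S. Q s (D s)) \<and> C = ?U D" if "C \<in> ?U ` PiE S \<C>" for C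
      using that families(3) by (auto simp: PiE_def Pi_def)
    fix I assume "\<exists>J. (\<forall>s\<in>S. P s (J s)) \<and> I = ?U J"
    then obtain J where classes: "\<And>s. s \<in> S \<Longrightarrow> P s (J s)" "I = ?U J" by blast
    then have "\<forall>s\<in>S. \<exists>C. C \<in> \<C> s \<and> J s \<subseteq> C" using families(4) by blast
    from bchoice[OF this] obtain D where "\<And>s. s \<in> S \<Longrightarrow> D s \<in> \<C> s \<and> J s \<subseteq> D s" by blast
    then have "I \<subseteq> ?U (restrict D S)" "restrict D S \<in> PiE S \<C>" using classes(2) by auto
    then show "\<exists>C\<in>?U ` PiE S \<C>. I \<subseteq> C" by blast
  qed
qed

lemma card_nonempty_subsets_le:
  assumes "finite L"
  shows "card {J. J \<subseteq> L \<and> J \<noteq> {}} \<le> 2 ^ card L"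
proof -
  have "card {J. J \<subseteq> L \<and> J \<noteq> {}} \<le> card (Pow L)" using assms by (intro card_mono) auto
  then show ?thesis using assms by (simp add: card_Pow)
qed

definition codegree :: "'e set \<Rightarrow> ('e \<Rightarrow> 'j \<Rightarrow> 'v) \<Rightarrow> 'j set \<Rightarrow> 'e \<Rightarrow> nat" where
  "codegree E x J a = card {b\<in>E. \<forall>j\<in>J. x b j = x a j}"

definition tuples_inside :: "'e set \<Rightarrow> ('e \<Rightarrow> 'j \<Rightarrow> 'v) \<Rightarrow> 'j set \<Rightarrow> 'v set \<Rightarrow> 'e set" where
  "tuples_inside E x L C = {a\<in>E. \<forall>j\<in>L. x a j \<in> C}"

definition independent :: "'e set \<Rightarrow> ('e \<Rightarrow> 'j \<Rightarrow> 'v) \<Rightarrow> 'j set \<Rightarrow> 'v set \<Rightarrow> 'v set \<Rightarrow> bool" where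
  "independent E x L V I \<longleftrightarrow> I \<subseteq> V \<and> tuples_inside E x L I = {}"

lemma independent_insert_imp:
  assumes "independent E x (insert i L) V I" "B \<subseteq> E" "\<And>a. a \<in> B \<Longrightarrow> x a i \<in> I"
  shows "independent B x L V I"
  using assms unfolding independent_def tuples_inside_def by blast

lemma independent_restrict:
  "independent E x L W I \<Longrightarrow> independent (tuples_inside E x L W) x L W I"
  unfolding independent_def tuples_inside_def by blast

lemma codegree_cong: "(\<And>j. j \<in> J \<Longrightarrow> x a j = x b j) \<Longrightarrow> codegree E x J a = codegree E x J b"
  unfolding codegree_def by (rule arg_cong[where f = card]) auto

lemma codegree_mono: "finite E \<Longrightarrow> B \<subseteq> E \<Longrightarrow> codegree B x J a \<le> codegree E x J a"
  unfolding codegree_def by (intro card_mono) auto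

lemma codegree_Un_le: "codegree (A \<union> B) x J a \<le> codegree A x J a + codegree B x J a"
proof -
  have "{b\<in>A \<union> B. \<forall>j\<in>J. x b j = x a j} = {b\<in>A. \<forall>j\<in>J. x b j = x a j} \<union> {b\<in>B. \<forall>j\<in>J. x b j = x a j}"
    by blast
  then show ?thesis unfolding codegree_def by (simp add: card_Un_le)
qed

lemma sum_codegree_swap:
  assumes "finite A" "finite B"
  shows "(\<Sum>a\<in>A. codegree B x J a) = (\<Sum>b\<in>B. codegree A x J b)"
proof -
  have "(\<Sum>a\<in>A. codegree B x J a) = (\<Sum>a\<in>A. \<Sum>b\<in>B. if \<forall>j\<in>J. x b j = x a j then 1 else 0)"
    using assms(2) by (simp add: codegree_def sum.If_cases Int_def)
  also have "\<dots> = (\<Sum>b\<in>B. \<Sum>a\<in>A. if \<forall>j\<in>J. x b j = x a j then 1 else 0)"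
    by (rule sum.swap)
  also have "\<dots> = (\<Sum>b\<in>B. codegree A x J b)"
    using assms(1) by (simp add: codegree_def sum.If_cases Int_def eq_commute)
  finally show ?thesis .
qed

text \<open>A hypergraph is a set \<open>E\<close> of labels together with coordinates \<open>x a j\<close>. Since the container
  algorithm consumes one coordinate at a time, its link hypergraphs are subsets of \<open>E\<close>, and
  multiplicities need no separate treatment.\<close>

locale tuple_system =
  fixes E :: "'e set" and x :: "'e \<Rightarrow> 'j \<Rightarrow> 'v" and L :: "'j set" and V :: "'v set"
    and N D p :: real
  assumes finite_tuples: "finite E" and finite_coordinates: "finite L"
    and finite_vertices: "finite V"
    and card_vertices_le: "real (card V) \<le> N"
    and coordinate_in_vertices: "a \<in> E \<Longrightarrow> j \<in> L \<Longrightarrow> x a j \<in> V"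
    and D_pos: "0 < D" and p_pos: "0 < p" and pN_ge_1: "1 \<le> p * N"
    and codegree_le: "a \<in> E \<Longrightarrow> J \<subseteq> L \<Longrightarrow> J \<noteq> {} \<Longrightarrow> real (codegree E x J a) \<le> D * p ^ (card J - 1)"
begin

lemma N_pos: "0 < N"
  using pN_ge_1 p_pos by (metis less_le_trans zero_less_mult_pos zero_less_one)

lemma tuple_system_restrict:
  assumes "W \<subseteq> V"
  shows "tuple_system (tuples_inside E x L W) x L W N D p"
proof
  let ?E = "tuples_inside E x L W"
  have sub: "?E \<subseteq> E" unfolding tuples_inside_def by blast
  show "real (codegree ?E x J a) \<le> D * p ^ (card J - 1)" if "a \<in> ?E" "J \<subseteq> L" "J \<noteq> {}" for a J
    using codegree_le[of a J] codegree_mono[OF finite_tuples sub, of x J a] that sub by force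
  show "real (card W) \<le> N"
    using card_mono[OF finite_vertices assms] card_vertices_le by linarith
  show "finite ?E" using sub finite_tuples by (rule finite_subset)
  show "finite W" using assms finite_vertices by (rule finite_subset)
qed (auto simp: tuples_inside_def finite_coordinates D_pos p_pos pN_ge_1)

lemma card_saturated_le:
  assumes "B \<subseteq> E" "J \<subseteq> L" "J \<noteq> {}" "0 < c"
  shows "real (card {a\<in>E. c * D * p ^ card J \<le> real (codegree B x J a)}) \<le> real (card B) / (c * p)"
proof -
  let ?S = "{a\<in>E. c * D * p ^ card J \<le> real (codegree B x J a)}"
  have finB: "finite B" using assms(1) finite_tuples by (rule finite_subset)
  have "real (card ?S) * (c * D * p ^ card J) = (\<Sum>a\<in>?S. c * D * p ^ card J)" by simp
  also have "\<dots> \<le> (\<Sum>a\<in>?S. real (codegree B x J a))" by (rule sum_mono) auto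
  also have "\<dots> \<le> (\<Sum>a\<in>E. real (codegree B x J a))" by (rule sum_mono2) (use finite_tuples in auto)
  also have "\<dots> = (\<Sum>b\<in>B. real (codegree E x J b))"
    using sum_codegree_swap[OF finite_tuples finB, of x J] by (simp flip: of_nat_sum)
  also have "\<dots> \<le> (\<Sum>b\<in>B. D * p ^ (card J - 1))"
    using codegree_le assms(1-3) by (intro sum_mono) auto
  finally have "real (card ?S) * (c * D * p ^ card J) \<le> real (card B) * (D * p ^ (card J - 1))"
    by simp
  moreover have "p ^ card J = p * p ^ (card J - 1)"
    using assms(2,3) finite_subset[OF _ finite_coordinates] by (cases "card J") auto
  ultimately have "(real (card ?S) * (c * p)) * (D * p ^ (card J - 1))
      \<le> real (card B) * (D * p ^ (card J - 1))"
    by (simp add: algebra_simps)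
  then show ?thesis
    using D_pos p_pos assms(4) by (simp add: mult_le_cancel_right pos_le_divide_eq)
qed

end

text \<open>One stage of the algorithm on coordinate \<open>i\<close>. As long as the independent set \<open>I\<close> contains a
  vertex \<open>v\<close> that is popular among the available tuples, move all available tuples with \<open>i\<close>-th
  coordinate \<open>v\<close> into \<open>B\<close>; tuples through a saturated codegree of \<open>B\<close> are no longer available. If
  this stops early, \<open>I\<close> avoids the many popular vertices; otherwise \<open>B\<close> is a large
  hypergraph on the remaining coordinates for which \<open>I\<close> is independent.\<close>

locale container_stage = tuple_system E x "insert i L" V N D p
  for E :: "'e set" and x :: "'e \<Rightarrow> 'j \<Rightarrow> 'v" and i :: 'j and L V N D p +
  fixes \<epsilon> :: real
  assumes i_notin: "i \<notin> L" and \<epsilon>_pos: "0 < \<epsilon>" and p_le: "p \<le> \<epsilon> / 4"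
    and dense: "\<epsilon> * D * N \<le> real (card E)"
begin

definition saturation :: real where
  "saturation = 2 ^ (card L + 2) / \<epsilon>"

definition available :: "'e set \<Rightarrow> 'e set" where
  "available B = {a\<in>E - B. \<forall>J. J \<subseteq> L \<and> J \<noteq> {} \<longrightarrow>
     real (codegree B x J a) < saturation * D * p ^ card J}"

definition available_at :: "'e set \<Rightarrow> 'v \<Rightarrow> 'e set" where
  "available_at B v = {a\<in>available B. x a i = v}"

definition popular :: "'e set \<Rightarrow> 'v set" where
  "popular B = {v\<in>V. \<epsilon> / 4 * D \<le> real (card (available_at B v))}"

definition selection :: "nat \<Rightarrow> 'e set \<Rightarrow> bool" where
  "selection t B \<longleftrightarrow> B \<subseteq> E \<and> tuple_system B x L V N ((saturation + 1) * p * D) p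
     \<and> real t * (\<epsilon> / 4 * D) \<le> real (card B) \<and> real (card B) \<le> real t * D"

lemma saturation_pos: "0 < saturation"
  unfolding saturation_def using \<epsilon>_pos by simp

lemma finite_L: "finite L"
  using finite_coordinates by simp

lemma available_subset: "available B \<subseteq> E - B"
  unfolding available_def by blast

lemma finite_available: "finite (available B)"
  using available_subset finite_tuples by (meson Diff_subset finite_subset)

lemma card_available_ge:
  assumes "B \<subseteq> E"
  shows "real (card E) \<le> real (card (available B)) + real (card B)
    + 2 ^ card L * (real (card B) / (saturation * p))"
proof -
  let ?Js = "{J. J \<subseteq> L \<and> J \<noteq> {}}"
  define S where "S J = {a\<in>E. saturation * D * p ^ card J \<le> real (codegree B x J a)}" for J
  have finJs: "finite ?Js" using finite_L by simp
  have finB: "finite B" using assms finite_tuples by (rule finite_subset)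
  have finS: "finite (S J)" for J unfolding S_def using finite_tuples by simp
  have "E \<subseteq> available B \<union> B \<union> (\<Union>J\<in>?Js. S J)"
  proof
    fix a assume a_in_E: "a \<in> E"
    show "a \<in> available B \<union> B \<union> (\<Union>J\<in>?Js. S J)"
    proof (cases "\<exists>J\<in>?Js. a \<in> S J")
      case False
      then have "real (codegree B x J a) < saturation * D * p ^ card J" if "J \<in> ?Js" for J
        using that a_in_E unfolding S_def by (metis (no_types, lifting) mem_Collect_eq not_less)
      then show ?thesis using a_in_E unfolding available_def by simp
    qed blast
  qed
  then have "card E \<le> card (available B \<union> B \<union> (\<Union>J\<in>?Js. S J))"
    using finite_available finB finJs finS by (intro card_mono) auto
  also have "\<dots> \<le> card (available B) + card B + card (\<Union>J\<in>?Js. S J)"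
    by (meson add_mono_thms_linordered_semiring(3) card_Un_le order_trans)
  also have "\<dots> \<le> card (available B) + card B + (\<Sum>J\<in>?Js. card (S J))"
    using card_UN_le[OF finJs, of S] by simp
  finally have "real (card E)
      \<le> real (card (available B)) + real (card B) + (\<Sum>J\<in>?Js. real (card (S J)))"
    by (simp flip: of_nat_add of_nat_sum)
  moreover have "(\<Sum>J\<in>?Js. real (card (S J))) \<le> real (card ?Js) * (real (card B) / (saturation * p))"
    unfolding S_def using card_saturated_le[OF assms _ _ saturation_pos]
    by (intro sum_bounded_above) auto
  moreover have "real (card ?Js) * (real (card B) / (saturation * p))
      \<le> 2 ^ card L * (real (card B) / (saturation * p))"
    using card_nonempty_subsets_le[OF finite_L] saturation_pos p_pos
    by (intro mult_right_mono) (simp_all flip: of_nat_le_iff)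
  ultimately show ?thesis by linarith
qed

lemma card_available_ge_half:
  assumes "selection t B" "real t \<le> p * N"
  shows "\<epsilon> / 2 * D * N \<le> real (card (available B))"
proof -
  have selected: "B \<subseteq> E" "real (card B) \<le> real t * D" using assms(1) unfolding selection_def by auto
  have cardB: "real (card B) \<le> p * (N * D)"
    using order_trans[OF selected(2) mult_right_mono[OF assms(2)]] D_pos by (simp add: mult.assoc)
  also have "\<dots> \<le> \<epsilon> / 4 * (N * D)" using p_le N_pos D_pos by (intro mult_right_mono) auto
  finally have "real (card B) \<le> \<epsilon> / 4 * D * N" by (simp add: mult_ac)
  moreover have "2 ^ card L * (real (card B) / (saturation * p)) \<le> \<epsilon> / 4 * D * N"
  proof -
    have "real (card B) / (saturation * p) \<le> p * (N * D) / (saturation * p)"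
      using cardB saturation_pos p_pos by (intro divide_right_mono) auto
    also have "\<dots> = N * D / saturation" using p_pos by simp
    finally have "2 ^ card L * (real (card B) / (saturation * p)) \<le> 2 ^ card L * (N * D / saturation)"
      by (intro mult_left_mono) auto
    also have "\<dots> = \<epsilon> / 4 * D * N"
      unfolding saturation_def using \<epsilon>_pos by (simp add: power_add field_simps)
    finally show ?thesis .
  qed
  ultimately have "\<epsilon> * D * N \<le> real (card (available B)) + \<epsilon> / 4 * D * N + \<epsilon> / 4 * D * N"
    using card_available_ge[OF selected(1)] dense by linarith
  then show ?thesis by (simp add: algebra_simps)
qed

lemma card_available_at_le: "real (card (available_at B v)) \<le> D"
proof (cases "\<exists>a\<in>E. x a i = v")
  case True
  then obtain a where witness: "a \<in> E" "x a i = v" by blast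
  have "card (available_at B v) \<le> codegree E x {i} a"
    unfolding codegree_def using finite_tuples available_subset witness(2)
    by (intro card_mono) (auto simp: available_at_def)
  then show ?thesis using codegree_le[of a "{i}"] witness(1) by simp
next
  case False
  then have "available_at B v = {}" using available_subset unfolding available_at_def by blast
  then show ?thesis using D_pos by simp
qed

lemma card_popular_ge:
  assumes "selection t B" "real t \<le> p * N"
  shows "\<epsilon> / 4 * N \<le> real (card (popular B))"
proof -
  have "(\<lambda>a. x a i) ` available B \<subseteq> V" using available_subset coordinate_in_vertices by blast
  then have "card (available B) = (\<Sum>v\<in>V. card (available_at B v))"
    using sum.group[OF finite_available finite_vertices, of "\<lambda>a. x a i" B "\<lambda>_. 1::nat"]
    unfolding available_at_def by simp
  then have "real (card (available B)) = (\<Sum>v\<in>V. real (card (available_at B v)))" by simp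
  also have "\<dots> \<le> (\<Sum>v\<in>V. (if v \<in> popular B then D else 0) + \<epsilon> / 4 * D)"
  proof (rule sum_mono)
    fix v assume "v \<in> V"
    show "real (card (available_at B v)) \<le> (if v \<in> popular B then D else 0) + \<epsilon> / 4 * D"
    proof (cases "v \<in> popular B")
      case True
      then show ?thesis
        using card_available_at_le[of B v] \<epsilon>_pos D_pos by (simp add: add_increasing2)
    next
      case False
      then show ?thesis using \<open>v \<in> V\<close> unfolding popular_def by simp
    qed
  qed
  also have "\<dots> = real (card (popular B)) * D + real (card V) * (\<epsilon> / 4 * D)"
    using finite_vertices by (simp add: sum.distrib sum.If_cases Int_def popular_def)
  also have "real (card V) * (\<epsilon> / 4 * D) \<le> N * (\<epsilon> / 4 * D)"
    using card_vertices_le \<epsilon>_pos D_pos by (intro mult_right_mono) auto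
  finally have "\<epsilon> / 4 * N * D \<le> real (card (popular B)) * D"
    using card_available_ge_half[OF assms] by (simp add: algebra_simps)
  then show ?thesis using D_pos by (simp add: mult_le_cancel_right)
qed

lemma codegree_available_le:
  assumes "B \<subseteq> E" "J \<subseteq> L" "J \<noteq> {}" "b \<in> available_at B v"
  shows "real (codegree (B \<union> available_at B v) x J b) \<le> (saturation + 1) * p * D * p ^ (card J - 1)"
proof -
  have b_available: "b \<in> E" "real (codegree B x J b) \<le> saturation * D * p ^ card J" "x b i = v"
    using assms unfolding available_at_def available_def by (auto intro: less_imp_le)
  have J_props: "finite J" "i \<notin> J" using assms(2) finite_L i_notin finite_subset by auto
  have "codegree (available_at B v) x J b \<le> codegree E x (insert i J) b"
    unfolding codegree_def using finite_tuples available_subset b_available(3)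
    by (intro card_mono) (auto simp: available_at_def)
  moreover have "real (codegree E x (insert i J) b) \<le> D * p ^ card J"
    using codegree_le[of b "insert i J"] b_available(1) assms(2) J_props by auto
  ultimately have "real (codegree (B \<union> available_at B v) x J b)
      \<le> saturation * D * p ^ card J + D * p ^ card J"
    using codegree_Un_le[of B "available_at B v" x J b] b_available(2) by linarith
  also have "\<dots> = (saturation + 1) * p * D * p ^ (card J - 1)"
    using J_props(1) assms(3) by (cases "card J") (auto simp: algebra_simps)
  finally show ?thesis .
qed

lemma tuple_system_extend:
  assumes "B \<subseteq> E" "tuple_system B x L V N ((saturation + 1) * p * D) p"
  shows "tuple_system (B \<union> available_at B v) x L V N ((saturation + 1) * p * D) p"
proof -
  interpret B: tuple_system B x L V N "(saturation + 1) * p * D" p by (rule assms(2))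
  let ?A = "available_at B v"
  have sub: "?A \<subseteq> E" using available_subset unfolding available_at_def by blast
  show ?thesis
  proof
    fix a J assume a_member: "a \<in> B \<union> ?A" and J_sub: "J \<subseteq> L" "J \<noteq> {}"
    show "real (codegree (B \<union> ?A) x J a) \<le> (saturation + 1) * p * D * p ^ (card J - 1)"
    proof (cases "\<exists>b\<in>?A. \<forall>j\<in>J. x b j = x a j")
      case True
      then obtain b where "b \<in> ?A" "\<And>j. j \<in> J \<Longrightarrow> x a j = x b j" by auto
      then show ?thesis
        using codegree_available_le[OF assms(1) J_sub] codegree_cong[of J x a b] by simp
    next
      case False
      then have "codegree (B \<union> ?A) x J a = codegree B x J a"
        unfolding codegree_def by (intro arg_cong[where f = card]) blast
      moreover have "a \<in> B" using a_member False by blast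
      ultimately show ?thesis using B.codegree_le J_sub by simp
    qed
  qed (use sub B.finite_tuples finite_tuples finite_L finite_vertices card_vertices_le
      coordinate_in_vertices assms(1) B.D_pos p_pos pN_ge_1 in \<open>auto intro: finite_subset\<close>)
qed

lemma selection_extend:
  assumes "selection t B" "v \<in> popular B"
  shows "selection (Suc t) (B \<union> available_at B v)"
proof -
  have selected: "B \<subseteq> E" "tuple_system B x L V N ((saturation + 1) * p * D) p"
    "real t * (\<epsilon> / 4 * D) \<le> real (card B)" "real (card B) \<le> real t * D"
    using assms(1) unfolding selection_def by auto
  have disjoint: "available_at B v \<subseteq> E - B"
    using available_subset unfolding available_at_def by blast
  then have "card (B \<union> available_at B v) = card B + card (available_at B v)"
    using selected(1) finite_tuples by (intro card_Un_disjoint) (auto intro: finite_subset)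
  moreover have "\<epsilon> / 4 * D \<le> real (card (available_at B v))"
    using assms(2) unfolding popular_def by simp
  ultimately show ?thesis
    unfolding selection_def
    using selected disjoint tuple_system_extend[OF selected(1,2)] card_available_at_le[of B v]
    by (auto simp: algebra_simps)
qed

lemma has_containers_branch:
  assumes sel: "selection t B" "real t \<le> p * N" and M_ge_1: "1 \<le> M"
    and large: "\<And>H. H \<subseteq> V \<Longrightarrow> \<epsilon> / 4 * N \<le> real (card H) \<Longrightarrow> Q (V - H)"
    and branch: "\<And>v. v \<in> popular B \<Longrightarrow> has_containers
      (\<lambda>I. independent E x (insert i L) V I \<and> (\<forall>a\<in>B \<union> available_at B v. x a i \<in> I)) Q M"
  shows "has_containers (\<lambda>I. independent E x (insert i L) V I \<and> (\<forall>a\<in>B. x a i \<in> I)) Q ((N + 1) * M)"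
proof -
  let ?indep = "independent E x (insert i L) V"
  have sub: "popular B \<subseteq> V" unfolding popular_def by blast
  then have "finite (popular B)" using finite_vertices by (rule finite_subset)
  then have "has_containers (\<lambda>I. \<exists>v\<in>popular B. ?indep I \<and> (\<forall>a\<in>B \<union> available_at B v. x a i \<in> I)) Q
      (real (card (popular B)) * M)"
    using branch by (rule has_containers_bex)
  moreover have "has_containers (\<lambda>I. I \<subseteq> V - popular B) Q 1"
    using large[OF sub] card_popular_ge[OF sel]
    by (intro has_containers_single[of _ "V - popular B"]) auto
  ultimately have "has_containers (\<lambda>I. (\<exists>v\<in>popular B. ?indep I \<and> (\<forall>a\<in>B \<union> available_at B v. x a i \<in> I))
      \<or> I \<subseteq> V - popular B) Q (real (card (popular B)) * M + 1)"
    by (intro has_containers_disj)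
  then show ?thesis
  proof (rule has_containers_mono)
    show "(\<exists>v\<in>popular B. ?indep I \<and> (\<forall>a\<in>B \<union> available_at B v. x a i \<in> I)) \<or> I \<subseteq> V - popular B"
      if indep: "?indep I \<and> (\<forall>a\<in>B. x a i \<in> I)" for I
    proof (cases "I \<inter> popular B = {}")
      case True
      then show ?thesis using indep unfolding independent_def by blast
    next
      case False
      then obtain v where "v \<in> I" "v \<in> popular B" by blast
      moreover have "x a i = v" if "a \<in> available_at B v" for a
        using that unfolding available_at_def by simp
      ultimately show ?thesis using indep by blast
    qed
    have "real (card (popular B)) \<le> N"
      using card_mono[OF finite_vertices sub] card_vertices_le by linarith
    then have "real (card (popular B)) * M \<le> N * M" using M_ge_1 by (intro mult_right_mono) auto
    then show "real (card (popular B)) * M + 1 \<le> (N + 1) * M"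
      unfolding distrib_right mult_1_left using M_ge_1 by linarith
  qed
qed

lemma has_containers_selection:
  assumes "selection t B" "real (t + m) \<le> p * N" "1 \<le> M"
    and complete: "\<And>B. selection (t + m) B \<Longrightarrow> has_containers (independent B x L V) Q M"
    and large: "\<And>H. H \<subseteq> V \<Longrightarrow> \<epsilon> / 4 * N \<le> real (card H) \<Longrightarrow> Q (V - H)"
  shows "has_containers (\<lambda>I. independent E x (insert i L) V I \<and> (\<forall>a\<in>B. x a i \<in> I)) Q
    ((N + 1) ^ m * M)"
  using assms(1,2) complete
proof (induction m arbitrary: t B)
  case 0
  then have "has_containers (independent B x L V) Q M" by simp
  moreover have "B \<subseteq> E" using 0 unfolding selection_def by simp
  ultimately have "has_containers (\<lambda>I. independent E x (insert i L) V I \<and> (\<forall>a\<in>B. x a i \<in> I)) Q M"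
    by (elim has_containers_mono) (auto intro: independent_insert_imp)
  then show ?case by simp
next
  case (Suc m)
  have "has_containers (\<lambda>I. independent E x (insert i L) V I \<and> (\<forall>a\<in>B. x a i \<in> I)) Q
      ((N + 1) * ((N + 1) ^ m * M))"
  proof (rule has_containers_branch[OF Suc.prems(1)])
    show "Q (V - H)" if "H \<subseteq> V" "\<epsilon> / 4 * N \<le> real (card H)" for H using that by (rule large)
    show "has_containers (\<lambda>I. independent E x (insert i L) V I
        \<and> (\<forall>a\<in>B \<union> available_at B v. x a i \<in> I)) Q ((N + 1) ^ m * M)" if "v \<in> popular B" for v
      using Suc.IH[OF selection_extend[OF Suc.prems(1) that]] Suc.prems(2,3) by simp
    have "1 * 1 \<le> (N + 1) ^ m * M" using N_pos assms(3) by (intro mult_mono) auto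
    then show "1 \<le> (N + 1) ^ m * M" by simp
  qed (use Suc.prems(2) in auto)
  then show ?case by (simp add: mult.assoc)
qed

lemma has_containers_omitting:
  assumes "1 \<le> M"
    and complete: "\<And>B. tuple_system B x L V N ((saturation + 1) * p * D) p
      \<Longrightarrow> \<epsilon> / (8 * (saturation + 1)) * ((saturation + 1) * p * D) * N \<le> real (card B)
      \<Longrightarrow> has_containers (independent B x L V) (\<lambda>C. C \<subseteq> V \<and> \<gamma> * N \<le> real (card (V - C))) M"
  shows "has_containers (independent E x (insert i L) V)
    (\<lambda>C. C \<subseteq> V \<and> min (\<epsilon> / 4) \<gamma> * N \<le> real (card (V - C))) ((N + 1) powr (p * N) * M)"
proof -
  let ?Q = "\<lambda>C. C \<subseteq> V \<and> min (\<epsilon> / 4) \<gamma> * N \<le> real (card (V - C))"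
  have min_le: "min (\<epsilon> / 4) \<gamma> * N \<le> \<epsilon> / 4 * N" "min (\<epsilon> / 4) \<gamma> * N \<le> \<gamma> * N"
    using N_pos by (auto intro!: mult_right_mono)
  define q where "q = nat \<lfloor>p * N\<rfloor>"
  have "1 \<le> \<lfloor>p * N\<rfloor>" using pN_ge_1 by (simp only: le_floor_iff of_int_1)
  then have q_bounds: "real q \<le> p * N" "p * N \<le> 2 * real q" unfolding q_def by linarith+
  have "has_containers (\<lambda>I. independent E x (insert i L) V I \<and> (\<forall>a\<in>{}. x a i \<in> I)) ?Q ((N + 1) ^ q * M)"
  proof (rule has_containers_selection[where t = 0])
    show "selection 0 {}"
      unfolding selection_def
      using finite_L finite_vertices card_vertices_le D_pos p_pos pN_ge_1 saturation_pos
      by (auto intro!: tuple_system.intro)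
    show "?Q (V - H)" if "H \<subseteq> V" "\<epsilon> / 4 * N \<le> real (card H)" for H
    proof -
      have "V - (V - H) = H" using that(1) by blast
      then show ?thesis using that(2) min_le(1) by auto
    qed
    fix B assume "selection (0 + q) B"
    then have link: "tuple_system B x L V N ((saturation + 1) * p * D) p"
      "real q * (\<epsilon> / 4 * D) \<le> real (card B)"
      unfolding selection_def by auto
    have "\<epsilon> / (8 * (saturation + 1)) * ((saturation + 1) * p * D) * N = p * N * (\<epsilon> / 8 * D)"
      using saturation_pos by (simp add: field_simps)
    also have "\<dots> \<le> 2 * real q * (\<epsilon> / 8 * D)"
      using q_bounds(2) \<epsilon>_pos D_pos by (intro mult_right_mono) auto
    also have "\<dots> \<le> real (card B)" using link(2) by (simp add: mult_ac)
    finally show "has_containers (independent B x L V) ?Q M"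
      using min_le(2) by (intro has_containers_mono[OF complete[OF link(1)]]) auto
  qed (use q_bounds(1) assms(1) in auto)
  moreover have "(N + 1) ^ q \<le> (N + 1) powr (p * N)"
    using N_pos q_bounds(1) by (subst powr_realpow[symmetric]) (auto intro: powr_mono)
  ultimately show ?thesis
    using assms(1) by (elim has_containers_mono) (auto intro: mult_right_mono)
qed

end

text \<open>The update of \<open>\<epsilon>\<close> is the one in \<open>has_containers_omitting\<close>, with \<open>saturation\<close> expanded.\<close>

fun container_gap :: "nat \<Rightarrow> real \<Rightarrow> real" where
  "container_gap 0 \<epsilon> = 1"
| "container_gap (Suc l) \<epsilon> = min (\<epsilon> / 4) (container_gap l (\<epsilon> / (8 * (2 ^ (l + 2) / \<epsilon> + 1))))"

lemma container_gap_pos: "0 < \<epsilon> \<Longrightarrow> 0 < container_gap l \<epsilon>"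
proof (induction l arbitrary: \<epsilon>)
  case (Suc l)
  then have "0 < \<epsilon> / (8 * (2 ^ (l + 2) / \<epsilon> + 1))"
    by (intro divide_pos_pos mult_pos_pos add_pos_pos) auto
  then show ?case using Suc by simp
qed simp

lemma has_containers_dense:
  assumes "tuple_system E x L V N D p" "0 < \<epsilon>" "p \<le> container_gap (card L) \<epsilon>"
    and "\<epsilon> * D * N \<le> real (card E)"
  shows "has_containers (independent E x L V)
    (\<lambda>C. C \<subseteq> V \<and> container_gap (card L) \<epsilon> * N \<le> real (card (V - C)))
    ((N + 1) powr (real (card L) * (p * N)))"
proof -
  have "finite L" using assms(1) by (rule tuple_system.finite_coordinates)
  then show ?thesis
    using assms
  proof (induction L arbitrary: E D \<epsilon>)
    case empty
    interpret tuple_system E x "{}" V N D p by (rule empty.prems(1))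
    have "0 < \<epsilon> * D * N" using empty.prems(2) D_pos N_pos by simp
    then have "E \<noteq> {}" using empty.prems(4) by auto
    then show ?case
      by (intro has_containers_none) (auto simp: independent_def tuples_inside_def)
  next
    case (insert i L)
    interpret container_stage E x i L V N D p \<epsilon>
      using insert by (auto intro!: container_stage.intro container_stage_axioms.intro)
    define \<eta> where "\<eta> = \<epsilon> / (8 * (saturation + 1))"
    have \<eta>_pos: "0 < \<eta>" unfolding \<eta>_def using \<epsilon>_pos saturation_pos by simp
    have gap: "container_gap (card (insert i L)) \<epsilon> = min (\<epsilon> / 4) (container_gap (card L) \<eta>)"
      using insert.hyps by (simp add: saturation_def \<eta>_def)
    have "1 \<le> (N + 1) powr (real (card L) * (p * N))"
      using N_pos p_pos by (intro ge_one_powr_ge_zero) auto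
    moreover have "has_containers (independent B x L V)
        (\<lambda>C. C \<subseteq> V \<and> container_gap (card L) \<eta> * N \<le> real (card (V - C)))
        ((N + 1) powr (real (card L) * (p * N)))"
      if "tuple_system B x L V N ((saturation + 1) * p * D) p"
        "\<eta> * ((saturation + 1) * p * D) * N \<le> real (card B)" for B
      using insert.IH[OF that(1) \<eta>_pos _ that(2)] insert.prems(3) by (simp add: gap)
    ultimately have "has_containers (independent E x (insert i L) V)
        (\<lambda>C. C \<subseteq> V \<and> container_gap (card (insert i L)) \<epsilon> * N \<le> real (card (V - C)))
        ((N + 1) powr (p * N) * (N + 1) powr (real (card L) * (p * N)))"
      unfolding gap \<eta>_def by (rule has_containers_omitting)
    then show ?case
      using insert.hyps N_pos by (simp add: algebra_simps flip: powr_add)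
  qed
qed

context tuple_system
begin

lemma has_containers_shrink:
  assumes "0 < \<epsilon>" "p \<le> container_gap (card L) \<epsilon>" "W \<subseteq> V"
    and "\<epsilon> * D * N \<le> real (card (tuples_inside E x L W))"
  shows "has_containers (independent E x L W)
    (\<lambda>C. C \<subseteq> W \<and> real (card C) \<le> real (card W) - container_gap (card L) \<epsilon> * N)
    ((N + 1) powr (real (card L) * (p * N)))"
  using has_containers_dense[OF tuple_system_restrict[OF assms(3)] assms(1,2,4)]
proof (rule has_containers_mono)
  have finW: "finite W" using assms(3) finite_vertices by (rule finite_subset)
  fix C assume omits: "C \<subseteq> W \<and> container_gap (card L) \<epsilon> * N \<le> real (card (W - C))"
  then have "real (card (W - C)) = real (card W) - real (card C)"
    using finW card_mono[OF finW] finite_subset[OF _ finW]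
    by (simp add: card_Diff_subset of_nat_diff)
  then show "C \<subseteq> W \<and> real (card C) \<le> real (card W) - container_gap (card L) \<epsilon> * N"
    using omits by simp
qed (auto intro: independent_restrict)

lemma has_containers_sparse_subset:
  assumes "L \<noteq> {}" "0 < \<epsilon>" "p \<le> container_gap (card L) \<epsilon>"
    and "W \<subseteq> V" "real (card W) \<le> real s * container_gap (card L) \<epsilon> * N"
  shows "has_containers (independent E x L W)
    (\<lambda>C. C \<subseteq> V \<and> real (card (tuples_inside E x L C)) < \<epsilon> * D * N)
    ((N + 1) powr (real (s * card L) * (p * N)))"
  using assms(4,5)
proof (induction s arbitrary: W)
  case 0
  then have "W = {}" using finite_subset[OF _ finite_vertices] by simp
  then show ?case
    using assms(1,2) D_pos N_pos
    by (intro has_containers_single[of _ "{}"]) (auto simp: independent_def tuples_inside_def)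
next
  case (Suc s)
  let ?Q = "\<lambda>C. C \<subseteq> V \<and> real (card (tuples_inside E x L C)) < \<epsilon> * D * N"
  show ?case
  proof (cases "?Q W")
    case True
    then show ?thesis
      using N_pos p_pos
      by (intro has_containers_single[of _ W] ge_one_powr_ge_zero) (auto simp: independent_def)
  next
    case False
    then have "\<epsilon> * D * N \<le> real (card (tuples_inside E x L W))" using Suc.prems(1) by simp
    then have "has_containers (independent E x L W) ?Q
        ((N + 1) powr (real (card L) * (p * N)) * (N + 1) powr (real (s * card L) * (p * N)))"
    proof (intro has_containers_refine[OF has_containers_shrink[OF assms(2,3) Suc.prems(1)]])
      fix C assume "C \<subseteq> W \<and> real (card C) \<le> real (card W) - container_gap (card L) \<epsilon> * N"
      then have "has_containers (independent E x L C) ?Q ((N + 1) powr (real (s * card L) * (p * N)))"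
        using Suc.prems by (intro Suc.IH) (auto simp: algebra_simps)
      then show "has_containers (\<lambda>I. I \<subseteq> C \<and> independent E x L W I) ?Q
          ((N + 1) powr (real (s * card L) * (p * N)))"
        by (rule has_containers_mono) (auto simp: independent_def)
    qed auto
    then show ?thesis by (simp add: algebra_simps flip: powr_add)
  qed
qed

theorem has_containers_sparse:
  assumes "L \<noteq> {}" "0 < \<epsilon>" "p \<le> container_gap (card L) \<epsilon>"
  shows "has_containers (independent E x L V)
    (\<lambda>C. C \<subseteq> V \<and> real (card (tuples_inside E x L C)) < \<epsilon> * D * N)
    ((N + 1) powr (real (nat \<lceil>1 / container_gap (card L) \<epsilon>\<rceil> * card L) * (p * N)))"
proof (rule has_containers_sparse_subset[OF assms order_refl])
  let ?\<gamma> = "container_gap (card L) \<epsilon>"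
  have "1 / ?\<gamma> \<le> real (nat \<lceil>1 / ?\<gamma>\<rceil>)" by linarith
  then have "1 \<le> real (nat \<lceil>1 / ?\<gamma>\<rceil>) * ?\<gamma>"
    using container_gap_pos[OF assms(2)] by (simp add: pos_divide_le_eq)
  then have "1 * N \<le> real (nat \<lceil>1 / ?\<gamma>\<rceil>) * ?\<gamma> * N"
    using N_pos by (intro mult_right_mono) auto
  then show "real (card V) \<le> real (nat \<lceil>1 / ?\<gamma>\<rceil>) * ?\<gamma> * N" using card_vertices_le by simp
qed

end

section \<open>Janson's inequality\<close>

definition random_subset :: "'v set \<Rightarrow> real \<Rightarrow> ('v \<Rightarrow> bool) pmf" where
  "random_subset A p = Pi_pmf A False (\<lambda>_. bernoulli_pmf p)"

definition present :: "'v set \<Rightarrow> ('v \<Rightarrow> bool) set" where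
  "present V = {X. \<forall>u\<in>V. X u}"

definition avoiding :: "('a \<Rightarrow> 'v set) \<Rightarrow> 'a set \<Rightarrow> ('v \<Rightarrow> bool) set" where
  "avoiding U \<Phi> = {X. \<forall>a\<in>\<Phi>. X \<notin> present (U a)}"

definition overlap_weight :: "real \<Rightarrow> ('a \<Rightarrow> 'v set) \<Rightarrow> 'a \<Rightarrow> 'a \<Rightarrow> real" where
  "overlap_weight p U a b = (if U a \<inter> U b = {} then 0 else p ^ card (U a \<union> U b))"

definition off_diagonal_sum :: "('a \<Rightarrow> 'a \<Rightarrow> real) \<Rightarrow> 'a set \<Rightarrow> real" where
  "off_diagonal_sum w S = (\<Sum>a\<in>S. \<Sum>b\<in>S - {a}. w a b)"

lemma overlap_weight_nonneg: "0 \<le> p \<Longrightarrow> 0 \<le> overlap_weight p U a b"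
  by (simp add: overlap_weight_def)

lemma avoiding_antimono: "\<Phi> \<subseteq> \<Psi> \<Longrightarrow> avoiding U \<Psi> \<subseteq> avoiding U \<Phi>"
  unfolding avoiding_def by blast

lemma off_diagonal_sum_insert:
  assumes "finite S" "b \<notin> S"
  shows "off_diagonal_sum w (insert b S) = off_diagonal_sum w S + (\<Sum>a\<in>S. w a b + w b a)"
proof -
  have "(\<Sum>c\<in>insert b S - {a}. w a c) = w a b + (\<Sum>c\<in>S - {a}. w a c)" if "a \<in> S" for a
  proof -
    have "insert b S - {a} = insert b (S - {a})" using that assms by auto
    then show ?thesis using assms by simp
  qed
  moreover have "insert b S - {b} = S" using assms by auto
  ultimately show ?thesis
    using assms unfolding off_diagonal_sum_def by (simp add: sum.distrib)
qed

text \<open>The right-hand side is the mean of \<open>(\<Sum>a\<in>S. \<alpha> a) - off_diagonal_sum w S\<close> over a random \<open>S\<close>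
  containing each point with probability \<open>s\<close>.\<close>

lemma exists_subset_ge_mean:
  fixes s :: real
  assumes "finite \<Phi>" "0 \<le> s" "s \<le> 1"
  shows "\<exists>S\<subseteq>\<Phi>. s * (\<Sum>a\<in>\<Phi>. \<alpha> a) - s\<^sup>2 * off_diagonal_sum w \<Phi> \<le> (\<Sum>a\<in>S. \<alpha> a) - off_diagonal_sum w S"
  using assms(1)
proof (induction \<Phi> arbitrary: \<alpha>)
  case empty
  then show ?case by (simp add: off_diagonal_sum_def)
next
  case (insert b \<Phi>)
  define \<beta> where "\<beta> a = \<alpha> a - (w a b + w b a)" for a
  define mean where "mean \<alpha> \<Phi> = s * (\<Sum>a\<in>\<Phi>. \<alpha> a) - s\<^sup>2 * off_diagonal_sum w \<Phi>" for \<alpha> \<Phi>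
  define val where "val \<alpha> S = (\<Sum>a\<in>S. \<alpha> a) - off_diagonal_sum w S" for \<alpha> S
  have IH: "\<exists>S\<subseteq>\<Phi>. mean \<gamma> \<Phi> \<le> val \<gamma> S" for \<gamma> using insert.IH unfolding mean_def val_def .
  have "mean \<alpha> (insert b \<Phi>) = (1 - s) * mean \<alpha> \<Phi> + s * (\<alpha> b + mean \<beta> \<Phi>)"
    using insert.hyps unfolding mean_def \<beta>_def
    by (simp add: off_diagonal_sum_insert sum_subtractf algebra_simps power2_eq_square)
  then have "\<not> (mean \<alpha> \<Phi> < mean \<alpha> (insert b \<Phi>) \<and> \<alpha> b + mean \<beta> \<Phi> < mean \<alpha> (insert b \<Phi>))"
    using convex_bound_lt[of "mean \<alpha> \<Phi>" "mean \<alpha> (insert b \<Phi>)" "\<alpha> b + mean \<beta> \<Phi>" "1 - s" s] assms(2,3)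
    by auto
  then consider "mean \<alpha> (insert b \<Phi>) \<le> mean \<alpha> \<Phi>" | "mean \<alpha> (insert b \<Phi>) \<le> \<alpha> b + mean \<beta> \<Phi>"
    by linarith
  then have "\<exists>S\<subseteq>insert b \<Phi>. mean \<alpha> (insert b \<Phi>) \<le> val \<alpha> S"
  proof cases
    case 1
    then show ?thesis using IH[of \<alpha>] by (meson order_trans subset_insertI2)
  next
    case 2
    obtain S where good: "S \<subseteq> \<Phi>" "mean \<beta> \<Phi> \<le> val \<beta> S" using IH by blast
    then have "finite S" "b \<notin> S" using insert.hyps finite_subset by auto
    then have "val \<alpha> (insert b S) = \<alpha> b + val \<beta> S"
      unfolding val_def \<beta>_def by (simp add: off_diagonal_sum_insert sum_subtractf)
    then show ?thesis using 2 good by (intro exI[of _ "insert b S"]) auto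
  qed
  then show ?case unfolding mean_def val_def .
qed

lemma prob_random_subset_insert:
  assumes "finite A" "u \<notin> A" "0 \<le> p" "p \<le> 1"
  shows "measure_pmf.prob (random_subset (insert u A) p) Z =
    p * measure_pmf.prob (random_subset A p) {X. X(u := True) \<in> Z}
    + (1 - p) * measure_pmf.prob (random_subset A p) {X. X(u := False) \<in> Z}"
proof -
  let ?P = "measure_pmf.prob (random_subset A p)"
  have bind: "random_subset (insert u A) p
      = bernoulli_pmf p \<bind> (\<lambda>y. map_pmf (\<lambda>f. f(u := y)) (random_subset A p))"
    unfolding random_subset_def using assms by (subst Pi_pmf_insert') (auto simp: map_pmf_def)
  have "emeasure (measure_pmf (random_subset (insert u A) p)) Z
     = ennreal (p * ?P {X. X(u := True) \<in> Z} + (1 - p) * ?P {X. X(u := False) \<in> Z})"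
    unfolding bind emeasure_bind_pmf using assms
    by (simp add: measure_pmf.emeasure_eq_measure vimage_def ennreal_mult' ennreal_plus mult.commute)
  then show ?thesis
    using assms by (simp add: measure_pmf.emeasure_eq_measure flip: ennreal_plus)
qed

locale bernoulli_product =
  fixes A :: "'v set" and p :: real
  assumes finite_points: "finite A" and p_nonneg: "0 \<le> p" and p_le_1: "p \<le> 1"
begin

abbreviation prob :: "('v \<Rightarrow> bool) set \<Rightarrow> real" where
  "prob \<equiv> measure_pmf.prob (random_subset A p)"

lemma prob_mono: "Y \<subseteq> Z \<Longrightarrow> prob Y \<le> prob Z"
  by (rule measure_pmf.finite_measure_mono) auto

lemma prob_point_present:
  assumes "u \<in> A"
  shows "prob {X. X u \<and> X \<in> Z} = p * prob {X. X(u := True) \<in> Z}"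
proof -
  obtain B where insert_B: "A = insert u B" "u \<notin> B" using assms by (meson Set.set_insert)
  then have "finite B" using finite_points by simp
  note split = prob_random_subset_insert[OF this insert_B(2) p_nonneg p_le_1]
  show ?thesis unfolding insert_B(1) split by (simp add: algebra_simps)
qed

lemma prob_present_Int:
  assumes "U \<subseteq> A"
  shows "prob (present U \<inter> Z) = p ^ card U * prob {X. (\<lambda>w. w \<in> U \<or> X w) \<in> Z}"
proof -
  have "finite U" using assms finite_points by (rule finite_subset)
  then show ?thesis
    using assms
  proof (induction U arbitrary: Z)
    case empty
    then show ?case by (simp add: present_def)
  next
    case (insert u U)
    have "present (insert u U) \<inter> Z = {X. X u \<and> X \<in> present U \<inter> Z}"
      unfolding present_def by auto
    then have "prob (present (insert u U) \<inter> Z) = p * prob {X. X(u := True) \<in> present U \<inter> Z}"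
      using prob_point_present[of u "present U \<inter> Z"] insert.prems by simp
    also have "{X. X(u := True) \<in> present U \<inter> Z} = present U \<inter> {X. X(u := True) \<in> Z}"
      using insert.hyps unfolding present_def by auto
    also have "prob \<dots> = p ^ card U * prob {X. (\<lambda>w. w \<in> U \<or> X w) \<in> {X. X(u := True) \<in> Z}}"
      using insert.prems by (intro insert.IH) simp
    also have "{X. (\<lambda>w. w \<in> U \<or> X w) \<in> {X. X(u := True) \<in> Z}} = {X. (\<lambda>w. w \<in> insert u U \<or> X w) \<in> Z}"
    proof -
      have "(\<lambda>w. w \<in> U \<or> X w)(u := True) = (\<lambda>w. w \<in> insert u U \<or> X w)" for X by auto
      then show ?thesis by simp
    qed
    finally show ?case using insert.hyps by simp
  qed
qed

text \<open>The special case of Harris' inequality that Janson's inequality needs: conditioning on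
  \<open>V\<close> being present amounts to adding \<open>V\<close>.\<close>

lemma prob_present_Int_avoiding_le:
  assumes "V \<subseteq> A"
  shows "prob (present V \<inter> avoiding U \<Phi>) \<le> p ^ card V * prob (avoiding U \<Phi>)"
  unfolding prob_present_Int[OF assms] using p_nonneg
  by (intro mult_left_mono prob_mono) (auto simp: avoiding_def present_def)

lemma prob_present_Int_avoiding_disjoint:
  assumes "V \<subseteq> A" "\<And>a. a \<in> \<Phi> \<Longrightarrow> U a \<inter> V = {}"
  shows "prob (present V \<inter> avoiding U \<Phi>) = p ^ card V * prob (avoiding U \<Phi>)"
proof -
  have "{X. (\<lambda>w. w \<in> V \<or> X w) \<in> avoiding U \<Phi>} = avoiding U \<Phi>"
    using assms(2) unfolding avoiding_def present_def by blast
  then show ?thesis using prob_present_Int[OF assms(1)] by simp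
qed

lemma prob_present_Int_avoiding_ge:
  assumes "finite \<Phi>" "\<And>a. a \<in> insert b \<Phi> \<Longrightarrow> U a \<subseteq> A"
  shows "(p ^ card (U b) - (\<Sum>a\<in>\<Phi>. overlap_weight p U a b)) * prob (avoiding U \<Phi>)
    \<le> prob (present (U b) \<inter> avoiding U \<Phi>)"
proof -
  define disj where "disj = {a\<in>\<Phi>. U a \<inter> U b = {}}"
  define t where "t = p ^ card (U b) - (\<Sum>a\<in>\<Phi>. overlap_weight p U a b)"
  let ?meet = "\<Phi> - disj"
  have "p ^ card (U b) * prob (avoiding U disj) = prob (present (U b) \<inter> avoiding U disj)"
    using assms(2) by (intro prob_present_Int_avoiding_disjoint[symmetric]) (auto simp: disj_def)
  also have "\<dots> \<le> prob ((present (U b) \<inter> avoiding U \<Phi>)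
      \<union> (\<Union>a\<in>?meet. present (U a \<union> U b) \<inter> avoiding U disj))"
    by (intro prob_mono) (auto simp: avoiding_def present_def)
  also have "\<dots> \<le> prob (present (U b) \<inter> avoiding U \<Phi>)
      + (\<Sum>a\<in>?meet. prob (present (U a \<union> U b) \<inter> avoiding U disj))"
    using assms(1)
    by (intro order_trans[OF measure_Un_le] add_left_mono
        measure_pmf.finite_measure_subadditive_finite) auto
  also have "(\<Sum>a\<in>?meet. prob (present (U a \<union> U b) \<inter> avoiding U disj))
      \<le> (\<Sum>a\<in>?meet. p ^ card (U a \<union> U b) * prob (avoiding U disj))"
    using assms(2) by (intro sum_mono prob_present_Int_avoiding_le) blast
  also have "\<dots> = (\<Sum>a\<in>\<Phi>. overlap_weight p U a b) * prob (avoiding U disj)"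
    unfolding overlap_weight_def sum_distrib_right using assms(1)
    by (intro sum.mono_neutral_cong_left) (auto simp: disj_def)
  finally have disj_bound: "t * prob (avoiding U disj) \<le> prob (present (U b) \<inter> avoiding U \<Phi>)"
    unfolding t_def by (simp add: algebra_simps)
  have "t * prob (avoiding U \<Phi>) \<le> prob (present (U b) \<inter> avoiding U \<Phi>)"
  proof (cases "0 \<le> t")
    case True
    have "prob (avoiding U \<Phi>) \<le> prob (avoiding U disj)"
      by (intro prob_mono avoiding_antimono) (auto simp: disj_def)
    then show ?thesis using disj_bound True by (meson mult_left_mono order_trans)
  next
    case False
    then have "t * prob (avoiding U \<Phi>) \<le> 0" by (simp add: mult_nonpos_nonneg)
    also have "0 \<le> prob (present (U b) \<inter> avoiding U \<Phi>)" by simp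
    finally show ?thesis .
  qed
  then show ?thesis unfolding t_def .
qed

lemma prob_avoiding_insert_le:
  assumes "finite \<Phi>" "\<And>a. a \<in> insert b \<Phi> \<Longrightarrow> U a \<subseteq> A"
  shows "prob (avoiding U (insert b \<Phi>))
    \<le> prob (avoiding U \<Phi>) * exp (- (p ^ card (U b) - (\<Sum>a\<in>\<Phi>. overlap_weight p U a b)))"
proof -
  let ?t = "p ^ card (U b) - (\<Sum>a\<in>\<Phi>. overlap_weight p U a b)"
  have "avoiding U (insert b \<Phi>) = avoiding U \<Phi> - present (U b) \<inter> avoiding U \<Phi>"
    unfolding avoiding_def by blast
  then have "prob (avoiding U (insert b \<Phi>)) = prob (avoiding U \<Phi>) - prob (present (U b) \<inter> avoiding U \<Phi>)"
    by (simp add: measure_pmf.finite_measure_Diff)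
  also have "\<dots> \<le> prob (avoiding U \<Phi>) * (1 + (- ?t))"
    using prob_present_Int_avoiding_ge[OF assms] by (simp add: algebra_simps)
  also have "\<dots> \<le> prob (avoiding U \<Phi>) * exp (- ?t)"
    by (intro mult_left_mono exp_ge_add_one_self) simp
  finally show ?thesis .
qed

lemma prob_avoiding_le_exp:
  assumes "finite \<Phi>" "\<And>a. a \<in> \<Phi> \<Longrightarrow> U a \<subseteq> A"
  shows "prob (avoiding U \<Phi>)
    \<le> exp (- ((\<Sum>a\<in>\<Phi>. p ^ card (U a)) - off_diagonal_sum (overlap_weight p U) \<Phi>))"
  using assms
proof (induction \<Phi>)
  case empty
  then show ?case by (simp add: off_diagonal_sum_def)
next
  case (insert b \<Phi>)
  let ?w = "overlap_weight p U"
  have "prob (avoiding U (insert b \<Phi>)) \<le> prob (avoiding U \<Phi>) * exp (- (p ^ card (U b) - (\<Sum>a\<in>\<Phi>. ?w a b)))"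
    using insert by (intro prob_avoiding_insert_le) auto
  also have "\<dots> \<le> exp (- ((\<Sum>a\<in>\<Phi>. p ^ card (U a)) - off_diagonal_sum ?w \<Phi>))
      * exp (- (p ^ card (U b) - (\<Sum>a\<in>\<Phi>. ?w a b)))"
    using insert by (intro mult_right_mono) auto
  also have "\<dots> \<le> exp (- ((\<Sum>a\<in>insert b \<Phi>. p ^ card (U a)) - off_diagonal_sum ?w (insert b \<Phi>)))"
    using insert.hyps
    by (simp add: off_diagonal_sum_insert sum.distrib sum_nonneg overlap_weight_nonneg[OF p_nonneg]
        flip: exp_add)
  finally show ?case .
qed

theorem janson_inequality:
  assumes "finite \<Phi>" "\<And>a. a \<in> \<Phi> \<Longrightarrow> U a \<subseteq> A"
    and "\<mu> \<le> (\<Sum>a\<in>\<Phi>. p ^ card (U a))" "off_diagonal_sum (overlap_weight p U) \<Phi> \<le> \<Delta>"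
    and "0 \<le> \<mu>" "0 < \<Delta>" "\<mu> \<le> 2 * \<Delta>"
  shows "prob (avoiding U \<Phi>) \<le> exp (- (\<mu>\<^sup>2 / (4 * \<Delta>)))"
proof -
  let ?mean = "\<lambda>S. \<Sum>a\<in>S. p ^ card (U a)" and ?overlap = "off_diagonal_sum (overlap_weight p U)"
  define s where "s = \<mu> / (2 * \<Delta>)"
  have s_bounds: "0 \<le> s" "s \<le> 1" unfolding s_def using assms(5-7) by auto
  obtain S where good: "S \<subseteq> \<Phi>" "s * ?mean \<Phi> - s\<^sup>2 * ?overlap \<Phi> \<le> ?mean S - ?overlap S"
    using exists_subset_ge_mean[OF assms(1) s_bounds, where \<alpha> = "\<lambda>a. p ^ card (U a)"] by meson
  have "\<mu>\<^sup>2 / (4 * \<Delta>) = s * \<mu> - s\<^sup>2 * \<Delta>"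
    unfolding s_def using assms(6) by (simp add: field_simps power2_eq_square)
  also have "\<dots> \<le> s * ?mean \<Phi> - s\<^sup>2 * ?overlap \<Phi>"
    using assms(3,4) s_bounds(1) by (intro diff_mono mult_left_mono) auto
  finally have mean_ge: "\<mu>\<^sup>2 / (4 * \<Delta>) \<le> ?mean S - ?overlap S" using good(2) by linarith
  have "prob (avoiding U \<Phi>) \<le> prob (avoiding U S)"
    by (intro prob_mono avoiding_antimono good(1))
  also have "\<dots> \<le> exp (- (?mean S - ?overlap S))"
    using assms(1,2) good(1) finite_subset by (intro prob_avoiding_le_exp) auto
  also have "\<dots> \<le> exp (- (\<mu>\<^sup>2 / (4 * \<Delta>)))" using mean_ge by simp
  finally show ?thesis .
qed

end

section \<open>Embeddings and Ramsey supersaturation\<close>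

lemma
  assumes "uniform_hypergraph k F"
  shows finite_verts: "finite (verts F)" and finite_edges: "finite (edges F)"
    and edge_subset: "e \<in> edges F \<Longrightarrow> e \<subseteq> verts F" and card_edge: "e \<in> edges F \<Longrightarrow> card e = k"
proof -
  show fin: "finite (verts F)" and sub: "e \<in> edges F \<Longrightarrow> e \<subseteq> verts F" and "e \<in> edges F \<Longrightarrow> card e = k"
    for e
    using assms unfolding uniform_hypergraph_def by auto
  then show "finite (edges F)" by (meson PowI finite_Pow_iff finite_subset subsetI)
qed

lemma finite_k_sets: "finite (k_sets k n)"
  unfolding k_sets_def by simp

lemma card_k_sets_le: "card (k_sets k n) \<le> n ^ k"
proof -
  have "card (k_sets k n) = n choose k" unfolding k_sets_def by (simp add: n_subsets)
  then show ?thesis by (cases "k \<le> n") (auto simp: binomial_le_pow binomial_eq_0)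
qed

definition injections :: "'a set \<Rightarrow> 'b set \<Rightarrow> ('a \<Rightarrow> 'b) set" where
  "injections A B = {f \<in> A \<rightarrow>\<^sub>E B. inj_on f A}"

definition embeddings :: "'a hypergraph \<Rightarrow> nat \<Rightarrow> ('a \<Rightarrow> nat) set" where
  "embeddings F n = injections (verts F) {1..n}"

definition image_edges :: "'a hypergraph \<Rightarrow> ('a \<Rightarrow> 'b) \<Rightarrow> 'b set set" where
  "image_edges F \<phi> = (\<lambda>e. \<phi> ` e) ` edges F"

definition embeddings_in :: "'a hypergraph \<Rightarrow> nat \<Rightarrow> nat set set \<Rightarrow> ('a \<Rightarrow> nat) set" where
  "embeddings_in F n K = {\<phi> \<in> embeddings F n. image_edges F \<phi> \<subseteq> K}"

lemma finite_injections: "finite A \<Longrightarrow> finite B \<Longrightarrow> finite (injections A B)"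
  unfolding injections_def by (simp add: finite_PiE)

lemma compose_in_injections:
  assumes "h \<in> injections A B" "g \<in> injections B C"
  shows "compose A g h \<in> injections A C"
  using assms unfolding injections_def inj_on_def by (auto simp: compose_def PiE_iff)

lemma card_injections_ge:
  assumes "2 * m \<le> n"
  shows "(real n / 2) ^ m \<le> real (card (injections {..<m} {1..n}))"
proof -
  have "card (injections {..<m} {1..n}) = (\<Prod>i<m. n - i)"
    using card_inj_on_subset_funcset[of "{..<m}" "{1..n}" "{..<m}"]
    by (simp add: injections_def lessThan_atLeast0)
  moreover have "(real n / 2) ^ m = (\<Prod>i<m. real n / 2)" by simp
  moreover have "\<dots> \<le> (\<Prod>i<m. real (n - i))"
    by (rule prod_mono) (use assms in auto)
  ultimately show ?thesis by simp
qed

lemma finite_embeddings: "finite (verts F) \<Longrightarrow> finite (embeddings F n)"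
  unfolding embeddings_def by (simp add: finite_injections)

lemma embeddings_in_subset: "embeddings_in F n K \<subseteq> embeddings F n"
  unfolding embeddings_in_def by blast

lemma finite_embeddings_in: "finite (verts F) \<Longrightarrow> finite (embeddings_in F n K)"
  using embeddings_in_subset finite_embeddings by (rule finite_subset)

lemma image_edges_subset_k_sets:
  assumes "uniform_hypergraph k F" "\<phi> \<in> embeddings F n"
  shows "image_edges F \<phi> \<subseteq> k_sets k n"
proof -
  have "\<phi> ` e \<in> k_sets k n" if "e \<in> edges F" for e
  proof -
    have "e \<subseteq> verts F" "card e = k"
      using edge_subset[OF assms(1) that] card_edge[OF assms(1) that] by auto
    then show ?thesis
      using assms(2) unfolding embeddings_def injections_def k_sets_def
      by (auto simp: card_image inj_on_subset)
  qed
  then show ?thesis unfolding image_edges_def by blast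
qed

lemma power_le_self_power:
  fixes a b v :: nat
  assumes "a \<le> v" "b \<le> v"
  shows "a ^ b \<le> v ^ v"
proof (cases "v = 0")
  case False
  have "a ^ b \<le> v ^ b" using assms(1) by (intro power_mono) auto
  also have "\<dots> \<le> v ^ v" using False assms(2) by (intro power_increasing) auto
  finally show ?thesis .
qed (use assms in simp)

lemma card_embeddings_into_le:
  assumes "finite (verts F)" "W \<subseteq> verts F" "finite Y" "card Y \<le> card (verts F)"
  shows "card {\<psi> \<in> embeddings F n. \<psi> ` W \<subseteq> Y}
    \<le> card (verts F) ^ card (verts F) * n ^ (card (verts F) - card W)"
proof -
  let ?B = "\<lambda>a. if a \<in> W then Y else {1..n}"
  have "card {\<psi> \<in> embeddings F n. \<psi> ` W \<subseteq> Y} \<le> card (PiE (verts F) ?B)"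
  proof (rule card_mono)
    show "finite (PiE (verts F) ?B)" using assms by (intro finite_PiE) auto
    show "{\<psi> \<in> embeddings F n. \<psi> ` W \<subseteq> Y} \<subseteq> PiE (verts F) ?B"
      unfolding embeddings_def injections_def by (auto simp: PiE_def Pi_def)
  qed
  also have "\<dots> = (\<Prod>a\<in>verts F. if a \<in> W then card Y else n)"
    using assms by (simp add: card_PiE if_distrib[of card] cong: if_cong)
  also have "\<dots> = card Y ^ card W * n ^ (card (verts F) - card W)"
  proof -
    have "verts F \<inter> {a. a \<in> W} = W" "verts F \<inter> - {a. a \<in> W} = verts F - W" using assms by auto
    then show ?thesis
      using assms finite_subset[OF assms(2)] by (simp add: prod.If_cases card_Diff_subset)
  qed
  also have "\<dots> \<le> card (verts F) ^ card (verts F) * n ^ (card (verts F) - card W)"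
    using assms card_mono by (intro mult_right_mono power_le_self_power) auto
  finally show ?thesis .
qed

lemma card_embeddings_in_le:
  assumes "finite (verts F)"
  shows "real (card (embeddings_in F n K)) \<le> real n ^ card (verts F)"
proof -
  have "card (embeddings_in F n K) \<le> card (verts F \<rightarrow>\<^sub>E {1..n})"
    using assms unfolding embeddings_in_def embeddings_def injections_def
    by (intro card_mono) (auto simp: finite_PiE)
  also have "\<dots> = n ^ card (verts F)" using assms by (simp add: card_PiE)
  finally show ?thesis by (simp flip: of_nat_power)
qed

lemma card_extensions_le:
  assumes "finite M" "finite Y" "finite \<Psi>" "h \<in> injections V M"
  shows "card {g \<in> M \<rightarrow>\<^sub>E Y. compose V g h \<in> \<Psi>} \<le> card \<Psi> * card Y ^ (card M - card V)"
proof -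
  let ?R = "M - h ` V" and ?G = "{g \<in> M \<rightarrow>\<^sub>E Y. compose V g h \<in> \<Psi>}"
  have h_inj: "h ` V \<subseteq> M" "inj_on h V" using assms(4) unfolding injections_def by auto
  have "card ?G \<le> card (\<Psi> \<times> (?R \<rightarrow>\<^sub>E Y))"
  proof (rule card_inj_on_le)
    show "inj_on (\<lambda>g. (compose V g h, restrict g ?R)) ?G"
    proof (rule inj_onI)
      fix g g' assume members: "g \<in> ?G" "g' \<in> ?G"
        and eq: "(compose V g h, restrict g ?R) = (compose V g' h, restrict g' ?R)"
      have "g y = g' y" if "y \<in> M" for y
      proof (cases "y \<in> h ` V")
        case True
        then obtain a where "a \<in> V" "y = h a" by blast
        moreover have "compose V g h a = compose V g' h a" using eq by simp
        ultimately show ?thesis by (simp add: compose_def)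
      next
        case False
        moreover have "restrict g ?R y = restrict g' ?R y" using eq by (metis prod.inject)
        ultimately show ?thesis using that by simp
      qed
      then show "g = g'" using members by (intro PiE_ext[of g M "\<lambda>_. Y" g']) auto
    qed
    show "finite (\<Psi> \<times> (?R \<rightarrow>\<^sub>E Y))" using assms by (auto intro!: finite_PiE)
  qed (auto simp: PiE_def)
  also have "\<dots> = card \<Psi> * card Y ^ (card M - card V)"
    using assms(1) h_inj finite_subset[OF h_inj(1) assms(1)]
    by (simp add: card_cartesian_product card_PiE card_Diff_subset card_image)
  finally show ?thesis .
qed

lemma ramsey_monochromatic_image:
  fixes k r :: nat and v :: "nat \<Rightarrow> nat"
  obtains m :: nat where "\<And>n C g. k_sets k n \<subseteq> (\<Union>i\<in>{1..r}. C i) \<Longrightarrow> g \<in> injections {..<m} {1..n} \<Longrightarrow>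
    \<exists>i\<in>{1..r}. \<exists>H\<subseteq>{..<m}. card H = v i \<and> (\<forall>e\<subseteq>H. card e = k \<longrightarrow> g ` e \<in> C i)"
proof -
  define vs where "vs = map (\<lambda>i. v (Suc i)) [0..<r]"
  obtain m :: nat where ramsey: "partn_lst {..<m} vs k" using ramsey_full[of vs k] by blast
  show ?thesis
  proof (rule that)
    fix n C g assume cover: "k_sets k n \<subseteq> (\<Union>i\<in>{1..r}. C i)" and "g \<in> injections {..<m} {1..n}"
    then have g_inj: "g \<in> {..<m} \<rightarrow>\<^sub>E {1..n}" "inj_on g {..<m}" unfolding injections_def by auto
    have "\<forall>e\<in>k_sets k n. \<exists>i. i \<in> {1..r} \<and> e \<in> C i" using cover by blast
    then obtain col where col: "\<And>e. e \<in> k_sets k n \<Longrightarrow> col e \<in> {1..r} \<and> e \<in> C (col e)" by metis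
    have image: "g ` e \<in> k_sets k n" if "e \<in> nsets {..<m} k" for e
      using that g_inj unfolding nsets_def k_sets_def by (auto simp: card_image inj_on_subset)
    have "(\<lambda>e. col (g ` e) - 1) \<in> nsets {..<m} k \<rightarrow> {..<length vs}"
    proof
      fix e assume "e \<in> nsets {..<m} k"
      then show "col (g ` e) - 1 \<in> {..<length vs}" using col[OF image] unfolding vs_def by fastforce
    qed
    then obtain i H where i_less: "i < length vs" and mono: "H \<in> nsets {..<m} (vs ! i)"
      "(\<lambda>e. col (g ` e) - 1) ` nsets H k \<subseteq> {i}"
      using partn_lstE[OF ramsey] by metis
    have subset: "H \<subseteq> {..<m}" "finite H" "card H = v (Suc i)"
      using i_less mono(1) unfolding nsets_def vs_def by auto
    have "g ` e \<in> C (Suc i)" if "e \<subseteq> H" "card e = k" for e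
    proof -
      have e_nsets: "e \<in> nsets H k"
        using that finite_subset[OF _ subset(2)] unfolding nsets_def by auto
      then have "e \<in> nsets {..<m} k" using nsets_mono[OF subset(1)] by blast
      note col = col[OF image[OF this]]
      have "col (g ` e) - 1 = i" using e_nsets mono(2) by blast
      then have "col (g ` e) = Suc i" using col by auto
      then show ?thesis using col by auto
    qed
    then show "\<exists>i\<in>{1..r}. \<exists>H\<subseteq>{..<m}. card H = v i \<and> (\<forall>e\<subseteq>H. card e = k \<longrightarrow> g ` e \<in> C i)"
      using i_less subset by (intro bexI[of _ "Suc i"] exI[of _ H]) (auto simp: vs_def)
  qed
qed

lemma embedding_in_through_subset:
  assumes unif: "uniform_hypergraph k F" and g_inj: "g \<in> injections M {1..n}"
    and H_sub: "H \<subseteq> M" "finite H" "card H = card (verts F)"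
    and images: "\<And>e. e \<subseteq> H \<Longrightarrow> card e = k \<Longrightarrow> g ` e \<in> K"
  shows "\<exists>h\<in>injections (verts F) M. compose (verts F) g h \<in> embeddings_in F n K"
proof -
  let ?V = "verts F"
  obtain h0 where bij: "bij_betw h0 ?V H"
    using finite_same_card_bij[OF finite_verts[OF unif] H_sub(2)] H_sub(3) by metis
  define h where "h = restrict h0 ?V"
  have h_image: "h ` ?V = H" "inj_on h ?V"
    using bij unfolding h_def bij_betw_def by (auto simp: inj_on_def)
  have h_inj: "h \<in> injections ?V M" using h_image H_sub(1) unfolding injections_def h_def by auto
  have "compose ?V g h ` e \<in> K" if "e \<in> edges F" for e
  proof -
    have edge: "e \<subseteq> ?V" "card e = k" using unif that by (auto simp: edge_subset card_edge)
    then have "h ` e \<subseteq> H" "card (h ` e) = k" using h_image by (auto simp: card_image inj_on_subset)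
    then have "g ` h ` e \<in> K" by (rule images)
    moreover have "compose ?V g h ` e = g ` h ` e" using edge(1) by (force simp: compose_def)
    ultimately show ?thesis by simp
  qed
  then have "compose ?V g h \<in> embeddings_in F n K"
    using compose_in_injections[OF h_inj g_inj]
    unfolding embeddings_in_def embeddings_def image_edges_def by auto
  then show ?thesis using h_inj by blast
qed

lemma ramsey_embedding:
  fixes F :: "nat \<Rightarrow> 'a hypergraph"
  assumes unif: "\<And>i. i \<in> {1..r} \<Longrightarrow> uniform_hypergraph k (F i)"
  obtains m :: nat where "\<And>n C g. k_sets k n \<subseteq> (\<Union>i\<in>{1..r}. C i) \<Longrightarrow> g \<in> injections {..<m} {1..n} \<Longrightarrow>
    \<exists>i\<in>{1..r}. \<exists>h\<in>injections (verts (F i)) {..<m}.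
      compose (verts (F i)) g h \<in> embeddings_in (F i) n (C i)"
proof -
  obtain m :: nat where mono: "\<And>n C g. k_sets k n \<subseteq> (\<Union>i\<in>{1..r}. C i) \<Longrightarrow> g \<in> injections {..<m} {1..n} \<Longrightarrow>
    \<exists>i\<in>{1..r}. \<exists>H\<subseteq>{..<m}. card H = card (verts (F i)) \<and> (\<forall>e\<subseteq>H. card e = k \<longrightarrow> g ` e \<in> C i)"
    using ramsey_monochromatic_image[of k r "\<lambda>i. card (verts (F i))"] by metis
  show ?thesis
  proof (rule that)
    fix n C g assume cover: "k_sets k n \<subseteq> (\<Union>i\<in>{1..r}. C i)" and g_inj: "g \<in> injections {..<m} {1..n}"
    then obtain i H where i_range: "i \<in> {1..r}"
      and H_mono: "H \<subseteq> {..<m}" "card H = card (verts (F i))"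
      "\<And>e. e \<subseteq> H \<Longrightarrow> card e = k \<Longrightarrow> g ` e \<in> C i"
      using mono[OF cover g_inj] by meson
    have "finite H" using H_mono(1) finite_lessThan by (rule finite_subset)
    then show "\<exists>i\<in>{1..r}. \<exists>h\<in>injections (verts (F i)) {..<m}.
        compose (verts (F i)) g h \<in> embeddings_in (F i) n (C i)"
      using embedding_in_through_subset[OF unif[OF i_range] g_inj H_mono(1) _ H_mono(2,3)] i_range
      by blast
  qed
qed

lemma card_maps_through_embeddings_in_le:
  assumes "finite (verts F)" "h \<in> injections (verts F) {..<m}"
    and "real (card (embeddings_in F n K)) \<le> \<delta> * real n ^ card (verts F)"
  shows "real (card {g \<in> {..<m} \<rightarrow>\<^sub>E {1..n}. compose (verts F) g h \<in> embeddings_in F n K})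
    \<le> \<delta> * real n ^ m"
proof -
  let ?v = "card (verts F)"
  have "?v \<le> m"
    using card_inj_on_le[of h "verts F" "{..<m}"] assms(2) unfolding injections_def by auto
  have "card {g \<in> {..<m} \<rightarrow>\<^sub>E {1..n}. compose (verts F) g h \<in> embeddings_in F n K}
      \<le> card (embeddings_in F n K) * n ^ (m - ?v)"
    using card_extensions_le[OF _ _ finite_embeddings_in[OF assms(1)] assms(2), of "{1..n}" n K]
    by simp
  then have "real (card {g \<in> {..<m} \<rightarrow>\<^sub>E {1..n}. compose (verts F) g h \<in> embeddings_in F n K})
      \<le> real (card (embeddings_in F n K)) * real n ^ (m - ?v)"
    by (simp flip: of_nat_mult of_nat_power)
  also have "\<dots> \<le> \<delta> * real n ^ ?v * real n ^ (m - ?v)"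
    using assms(3) by (intro mult_right_mono) auto
  also have "\<dots> = \<delta> * real n ^ m" using \<open>?v \<le> m\<close> by (simp flip: power_add)
  finally show ?thesis .
qed

lemma card_injections_le_of_few_embeddings:
  assumes "finite S" "\<And>i. i \<in> S \<Longrightarrow> finite (verts (F i))"
    and through: "\<And>g. g \<in> injections {..<m} {1..n} \<Longrightarrow> \<exists>i\<in>S. \<exists>h\<in>injections (verts (F i)) {..<m}.
      compose (verts (F i)) g h \<in> embeddings_in (F i) n (C i)"
    and few: "\<And>i. i \<in> S \<Longrightarrow> real (card (embeddings_in (F i) n (C i))) \<le> \<delta> * real n ^ card (verts (F i))"
  shows "real (card (injections {..<m} {1..n}))
    \<le> real (\<Sum>i\<in>S. card (injections (verts (F i)) {..<m})) * (\<delta> * real n ^ m)"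
proof -
  define hs where "hs i = injections (verts (F i)) {..<m}" for i
  define ext where "ext i h = {g \<in> {..<m} \<rightarrow>\<^sub>E {1..n}.
    compose (verts (F i)) g h \<in> embeddings_in (F i) n (C i)}" for i h
  have fin: "finite (hs i)" "finite (ext i h)" if "i \<in> S" for i h
    using assms(2)[OF that] unfolding hs_def ext_def by (auto simp: finite_injections finite_PiE)
  have "injections {..<m} {1..n} \<subseteq> (\<Union>i\<in>S. \<Union>h\<in>hs i. ext i h)"
  proof
    fix g assume g_inj: "g \<in> injections {..<m} {1..n}"
    then obtain i h where "i \<in> S" "h \<in> hs i" "compose (verts (F i)) g h \<in> embeddings_in (F i) n (C i)"
      using through unfolding hs_def by blast
    then show "g \<in> (\<Union>i\<in>S. \<Union>h\<in>hs i. ext i h)" using g_inj unfolding ext_def injections_def by blast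
  qed
  then have "card (injections {..<m} {1..n}) \<le> card (\<Union>i\<in>S. \<Union>h\<in>hs i. ext i h)"
    using assms(1) fin by (intro card_mono) auto
  also have "\<dots> \<le> (\<Sum>i\<in>S. \<Sum>h\<in>hs i. card (ext i h))"
    using assms(1) fin by (intro order_trans[OF card_UN_le] sum_mono card_UN_le) auto
  finally have "real (card (injections {..<m} {1..n})) \<le> (\<Sum>i\<in>S. \<Sum>h\<in>hs i. real (card (ext i h)))"
    by (simp flip: of_nat_sum)
  also have "\<dots> \<le> (\<Sum>i\<in>S. \<Sum>h\<in>hs i. \<delta> * real n ^ m)"
    unfolding ext_def hs_def using assms(2) few
    by (intro sum_mono card_maps_through_embeddings_in_le) auto
  also have "\<dots> = real (\<Sum>i\<in>S. card (hs i)) * (\<delta> * real n ^ m)" by (simp add: sum_distrib_right)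
  finally show ?thesis unfolding hs_def .
qed

definition ramsey_supersaturated ::
  "nat \<Rightarrow> nat \<Rightarrow> (nat \<Rightarrow> 'a hypergraph) \<Rightarrow> nat \<Rightarrow> real \<Rightarrow> bool" where
  "ramsey_supersaturated k r F n \<delta> \<longleftrightarrow> (\<forall>C. k_sets k n \<subseteq> (\<Union>i\<in>{1..r}. C i) \<longrightarrow>
     (\<exists>i\<in>{1..r}. \<delta> * real n ^ card (verts (F i)) \<le> real (card (embeddings_in (F i) n (C i)))))"

theorem ramsey_supersaturation:
  fixes F :: "nat \<Rightarrow> 'a hypergraph"
  assumes unif: "\<And>i. i \<in> {1..r} \<Longrightarrow> uniform_hypergraph k (F i)"
  obtains \<delta> where "0 < \<delta>" "\<forall>\<^sub>F n in sequentially. ramsey_supersaturated k r F n \<delta>"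
proof -
  obtain m :: nat where through: "\<And>n C g. k_sets k n \<subseteq> (\<Union>i\<in>{1..r}. C i) \<Longrightarrow> g \<in> injections {..<m} {1..n} \<Longrightarrow>
    \<exists>i\<in>{1..r}. \<exists>h\<in>injections (verts (F i)) {..<m}.
      compose (verts (F i)) g h \<in> embeddings_in (F i) n (C i)"
    by (rule ramsey_embedding[OF unif]) (assumption, rule that)
  define s where "s = (\<Sum>i\<in>{1..r}. card (injections (verts (F i)) {..<m}))"
  define \<delta> :: real where "\<delta> = 1 / (2 ^ m * (real s + 1))"
  have "ramsey_supersaturated k r F n \<delta>" if n_ge: "2 * m + 1 \<le> n" for n
    unfolding ramsey_supersaturated_def
  proof (intro allI impI, rule ccontr)
    fix C assume cover: "k_sets k n \<subseteq> (\<Union>i\<in>{1..r}. C i)"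
      and "\<not> (\<exists>i\<in>{1..r}. \<delta> * real n ^ card (verts (F i)) \<le> real (card (embeddings_in (F i) n (C i))))"
    then have few: "real (card (embeddings_in (F i) n (C i))) \<le> \<delta> * real n ^ card (verts (F i))"
      if "i \<in> {1..r}" for i using that by (meson less_imp_le not_le)
    have "(real n / 2) ^ m \<le> real (card (injections {..<m} {1..n}))"
      using n_ge by (intro card_injections_ge) simp
    also have "\<dots> \<le> real s * (\<delta> * real n ^ m)"
      unfolding s_def using through[OF cover] few unif
      by (intro card_injections_le_of_few_embeddings) (auto intro: finite_verts)
    also have "\<dots> = real s / (real s + 1) * (real n / 2) ^ m"
      unfolding \<delta>_def by (simp add: power_divide)
    also have "\<dots> < 1 * (real n / 2) ^ m"
      using n_ge by (intro mult_strict_right_mono) auto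
    finally show False by simp
  qed
  then have "\<forall>\<^sub>F n in sequentially. ramsey_supersaturated k r F n \<delta>"
    by (rule eventually_sequentiallyI)
  moreover have "0 < \<delta>" unfolding \<delta>_def by simp
  ultimately show ?thesis by (intro that)
qed

section \<open>Densities\<close>

lemma finite_subhypergraphs:
  assumes "uniform_hypergraph k F"
  shows "finite {H. subhypergraph H F}"
proof (rule finite_subset)
  show "{H. subhypergraph H F} \<subseteq> (\<lambda>(A, B). Hypergraph A B) ` (Pow (verts F) \<times> Pow (edges F))"
  proof
    fix H assume "H \<in> {H. subhypergraph H F}"
    then have "H = (\<lambda>(A, B). Hypergraph A B) (verts H, edges H)"
      "(verts H, edges H) \<in> Pow (verts F) \<times> Pow (edges F)"
      unfolding subhypergraph_def by auto
    then show "H \<in> (\<lambda>(A, B). Hypergraph A B) ` (Pow (verts F) \<times> Pow (edges F))" by blast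
  qed
  show "finite ((\<lambda>(A, B). Hypergraph A B) ` (Pow (verts F) \<times> Pow (edges F)))"
    using finite_verts[OF assms] finite_edges[OF assms] by simp
qed

lemma subhypergraph_spanned:
  assumes "uniform_hypergraph k F" "J \<subseteq> edges F"
  shows "subhypergraph (Hypergraph (\<Union>J) J) F"
  using assms unfolding subhypergraph_def uniform_hypergraph_def by auto

lemma card_spanned:
  assumes "uniform_hypergraph k F" "J \<subseteq> edges F" "J \<noteq> {}"
  shows card_spanned_ge: "k \<le> card (\<Union>J)" and card_spanned_le: "card (\<Union>J) \<le> card (verts F)"
proof -
  have sub: "\<Union>J \<subseteq> verts F" using assms(2) edge_subset[OF assms(1)] by blast
  then show "card (\<Union>J) \<le> card (verts F)" by (rule card_mono[OF finite_verts[OF assms(1)]])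
  obtain e where "e \<in> J" using assms(3) by blast
  then have "card e = k" "e \<subseteq> \<Union>J" using assms(2) card_edge[OF assms(1)] by auto
  then show "k \<le> card (\<Union>J)"
    using card_mono[OF finite_subset[OF sub finite_verts[OF assms(1)]]] by auto
qed

lemma card_edges_pos:
  assumes "uniform_hypergraph k F" "J \<subseteq> edges F" "J \<noteq> {}"
  shows "1 \<le> card J"
  using assms finite_subset[OF assms(2) finite_edges[OF assms(1)]]
  by (simp add: Suc_leI card_gt_0_iff)

lemma k_density_le_max:
  assumes "uniform_hypergraph k F" "subhypergraph H F"
  shows "k_density k H \<le> max_k_density k F"
  unfolding max_k_density_def using finite_subhypergraphs[OF assms(1)] assms(2)
  by (intro Max_ge) (auto simp: setcompr_eq_image)

lemma max_k_density_attained: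
  assumes "uniform_hypergraph k F"
  obtains H where "subhypergraph H F" "max_k_density k F = k_density k H"
proof -
  have "max_k_density k F \<in> {k_density k H | H. subhypergraph H F}"
    unfolding max_k_density_def
  proof (rule Max_in)
    show "finite {k_density k H | H. subhypergraph H F}"
      using finite_subhypergraphs[OF assms] by (simp add: setcompr_eq_image)
    have "subhypergraph (Hypergraph {} {}) F" unfolding subhypergraph_def by simp
    then show "{k_density k H | H. subhypergraph H F} \<noteq> {}" by blast
  qed
  then show ?thesis using that by blast
qed

lemma
  assumes unif: "uniform_hypergraph k F" and pos: "0 < max_k_density k F"
  shows edges_nonempty: "edges F \<noteq> {}" and uniformity_pos: "0 < k"
proof -
  obtain H where H_dense: "subhypergraph H F" "0 < k_density k H"
    using max_k_density_attained[OF unif] pos by metis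
  have sub: "edges H \<subseteq> edges F" using H_dense(1) unfolding subhypergraph_def by simp
  have nonempty: "card (edges H) \<noteq> 0"
    using H_dense(2) unfolding k_density_def by (auto split: if_splits)
  then show "edges F \<noteq> {}" using sub by auto
  show "0 < k"
  proof (rule ccontr)
    assume "\<not> 0 < k"
    then have "edges H \<subseteq> {{}}"
      using sub edge_subset[OF unif] card_edge[OF unif] finite_subset[OF _ finite_verts[OF unif]]
      by fastforce
    then have "card (edges H) = 1" using nonempty card_mono[of "{{}}" "edges H"] by simp
    then show False using H_dense(2) \<open>\<not> 0 < k\<close> unfolding k_density_def by (simp split: if_splits)
  qed
qed

lemma max_k_density_ge_inverse:
  assumes "uniform_hypergraph k F" "edges F \<noteq> {}"
  shows "1 / real k \<le> max_k_density k F"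
proof -
  obtain e where edge: "e \<in> edges F" using assms by blast
  then have "subhypergraph (Hypergraph e {e}) F"
    using subhypergraph_spanned[OF assms(1), of "{e}"] by simp
  moreover have "k_density k (Hypergraph e {e}) = 1 / real k"
    using card_edge[OF assms(1) edge] unfolding k_density_def by simp
  ultimately show ?thesis using k_density_le_max[OF assms(1)] by metis
qed

lemma inverse_max_k_density_le:
  assumes "uniform_hypergraph k F" "0 < max_k_density k F"
  shows "1 / max_k_density k F \<le> real k"
  using max_k_density_ge_inverse[OF assms(1) edges_nonempty[OF assms]] uniformity_pos[OF assms] assms(2)
  by (simp add: field_simps)

lemma card_spanned_gt:
  assumes "uniform_hypergraph k F" "J \<subseteq> edges F" "2 \<le> card J"
  shows "k < card (\<Union>J)"
proof -
  have "\<Union>J \<subseteq> verts F" using assms(2) edge_subset[OF assms(1)] by blast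
  then have fin: "finite (\<Union>J)" using finite_verts[OF assms(1)] by (rule finite_subset)
  have "card (\<Union>J) \<noteq> k"
  proof
    assume "card (\<Union>J) = k"
    then have "e = \<Union>J" if "e \<in> J" for e
      using that assms(2) card_edge[OF assms(1)] by (intro card_subset_eq[OF fin]) auto
    then have "J \<subseteq> {\<Union>J}" by blast
    then show False using card_mono[of "{\<Union>J}" J] assms(3) by simp
  qed
  moreover have "J \<noteq> {}" using assms(3) by auto
  ultimately show ?thesis using card_spanned_ge[OF assms(1,2)] by simp
qed

lemma card_edges_le_max_k_density:
  assumes unif: "uniform_hypergraph k F" and J_edges: "J \<subseteq> edges F" "J \<noteq> {}"
  shows "real (card J) - 1 \<le> max_k_density k F * (real (card (\<Union>J)) - real k)"
proof (cases "card J = 1")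
  case True
  then obtain e where "J = {e}" using card_1_singletonE by blast
  then show ?thesis using card_edge[OF unif] J_edges by simp
next
  case False
  then have "2 \<le> card J" using card_edges_pos[OF unif J_edges] by simp
  then have "k < card (\<Union>J)" by (rule card_spanned_gt[OF unif J_edges(1)])
  moreover have "(real (card J) - 1) / (real (card (\<Union>J)) - real k) = k_density k (Hypergraph (\<Union>J) J)"
    using \<open>2 \<le> card J\<close> unfolding k_density_def by simp
  then have "(real (card J) - 1) / (real (card (\<Union>J)) - real k) \<le> max_k_density k F"
    using k_density_le_max[OF unif subhypergraph_spanned[OF unif J_edges(1)]] by simp
  ultimately show ?thesis by (simp add: pos_divide_le_eq)
qed

lemma card_edges_le_asym_k_density:
  assumes unif: "uniform_hypergraph k F" and pos: "0 < max_k_density k F'"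
    and J_edges: "J \<subseteq> edges F" "J \<noteq> {}"
  shows "real (card J) / asym_k_density k F F' \<le> real (card (\<Union>J)) - real k + 1 / max_k_density k F'"
proof -
  define d where "d H = real (card (edges H)) / (real (card (verts H)) - real k + 1 / max_k_density k F')"
    for H :: "'a hypergraph"
  let ?H = "Hypergraph (\<Union>J) J"
  have den_pos: "0 < real (card (\<Union>J)) - real k + 1 / max_k_density k F'"
    using card_spanned_ge[OF unif J_edges] pos by (simp add: add_nonneg_pos)
  have "d ?H \<le> asym_k_density k F F'"
    unfolding asym_k_density_def d_def[symmetric]
  proof (rule Max_ge)
    show "finite {d H |H. subhypergraph H F \<and> 1 \<le> card (edges H)}"
      using finite_subhypergraphs[OF unif] by (simp add: setcompr_eq_image)
    show "d ?H \<in> {d H |H. subhypergraph H F \<and> 1 \<le> card (edges H)}"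
      using subhypergraph_spanned[OF unif J_edges(1)] card_edges_pos[OF unif J_edges] by force
  qed
  moreover have "0 < d ?H" unfolding d_def using den_pos card_edges_pos[OF unif J_edges] by simp
  ultimately have "0 < asym_k_density k F F'" "d ?H \<le> asym_k_density k F F'" by linarith+
  then show ?thesis
    unfolding d_def using den_pos by (simp add: pos_divide_le_eq mult.commute)
qed

section \<open>Containers for hypergraphs without a copy of \<open>F\<close>\<close>

lemma embeddings_in_eq_tuples_inside:
  "embeddings_in F n C = tuples_inside (embeddings F n) (\<lambda>\<phi> e. \<phi> ` e) (edges F) C"
  unfolding embeddings_in_def tuples_inside_def image_edges_def by blast

lemma codegree_embeddings_le:
  assumes unif: "uniform_hypergraph k F" and J_edges: "J \<subseteq> edges F"
  shows "codegree (embeddings F n) (\<lambda>\<phi> e. \<phi> ` e) J \<phi>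
    \<le> card (verts F) ^ card (verts F) * n ^ (card (verts F) - card (\<Union>J))"
proof -
  have sub: "\<Union>J \<subseteq> verts F" using J_edges edge_subset[OF unif] by blast
  have fin: "finite (\<Union>J)" using sub finite_verts[OF unif] by (rule finite_subset)
  have "codegree (embeddings F n) (\<lambda>\<phi> e. \<phi> ` e) J \<phi> \<le> card {\<psi> \<in> embeddings F n. \<psi> ` \<Union>J \<subseteq> \<phi> ` \<Union>J}"
    unfolding codegree_def
  proof (rule card_mono)
    show "finite {\<psi> \<in> embeddings F n. \<psi> ` \<Union>J \<subseteq> \<phi> ` \<Union>J}"
      using finite_embeddings[OF finite_verts[OF unif]] by simp
    show "{\<psi> \<in> embeddings F n. \<forall>e\<in>J. \<psi> ` e = \<phi> ` e} \<subseteq> {\<psi> \<in> embeddings F n. \<psi> ` \<Union>J \<subseteq> \<phi> ` \<Union>J}"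
      by blast
  qed
  also have "\<dots> \<le> card (verts F) ^ card (verts F) * n ^ (card (verts F) - card (\<Union>J))"
    using finite_verts[OF unif] fin sub card_image_le[OF fin, of \<phi>] card_mono[OF finite_verts[OF unif] sub]
    by (intro card_embeddings_into_le) auto
  finally show ?thesis .
qed

lemma power_spanned_le:
  assumes unif: "uniform_hypergraph k F" and pos: "0 < max_k_density k F" and n_ge_1: "1 \<le> n"
    and J_edges: "J \<subseteq> edges F" "J \<noteq> {}"
  shows "real n ^ (card (verts F) - card (\<Union>J))
    \<le> real n ^ (card (verts F) - k) * (real n powr (- 1 / max_k_density k F)) ^ (card J - 1)"
proof -
  let ?m = "max_k_density k F" and ?v = "card (verts F)" and ?w = "card (\<Union>J)"
  have w_bounds: "k \<le> ?w" "?w \<le> ?v" using card_spanned[OF unif J_edges] .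
  have "(real (card J) - 1) / ?m \<le> real ?w - real k"
    using card_edges_le_max_k_density[OF unif J_edges] pos
    by (simp add: pos_divide_le_eq mult.commute)
  then have "real n powr - (real ?w - real k) \<le> real n powr - ((real (card J) - 1) / ?m)"
    using n_ge_1 by (intro powr_mono) auto
  also have "\<dots> = (real n powr (- 1 / ?m)) ^ (card J - 1)"
    using n_ge_1 card_edges_pos[OF unif J_edges]
    by (simp add: powr_realpow[symmetric] powr_powr of_nat_diff)
  finally have "real n ^ (?v - k) * real n powr - (real ?w - real k)
      \<le> real n ^ (?v - k) * (real n powr (- 1 / ?m)) ^ (card J - 1)"
    by (rule mult_left_mono) simp
  moreover have "real n ^ (?v - k) * real n powr - (real ?w - real k) = real n ^ (?v - ?w)"
    using n_ge_1 w_bounds by (simp add: powr_realpow[symmetric] of_nat_diff flip: powr_add)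
  ultimately show ?thesis by simp
qed

lemma inverse_density_power_mult:
  assumes "1 \<le> n"
  shows "real n powr (- 1 / m) * real n ^ k = real n powr (real k - 1 / m)"
  using assms by (simp add: powr_realpow[symmetric] flip: powr_add)

lemma tuple_system_embeddings:
  assumes unif: "uniform_hypergraph k F" and pos: "0 < max_k_density k F" and n_ge_1: "1 \<le> n"
  defines "v \<equiv> card (verts F)"
  shows "tuple_system (embeddings F n) (\<lambda>\<phi> e. \<phi> ` e) (edges F) (k_sets k n)
    (real n ^ k) (real (v ^ v) * real n ^ (v - k)) (real n powr (- 1 / max_k_density k F))"
proof
  have "0 < v"
    using card_spanned[OF unif order_refl edges_nonempty[OF unif pos]] uniformity_pos[OF unif pos]
    unfolding v_def by linarith
  then show "0 < real (v ^ v) * real n ^ (v - k)" using n_ge_1 by simp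
  show "real (card (k_sets k n)) \<le> real n ^ k"
    using card_k_sets_le[of k n] by (simp flip: of_nat_power)
  show "\<phi> ` e \<in> k_sets k n" if "\<phi> \<in> embeddings F n" "e \<in> edges F" for \<phi> e
    using image_edges_subset_k_sets[OF unif that(1)] that(2) unfolding image_edges_def by blast
  show "1 \<le> real n powr (- 1 / max_k_density k F) * real n ^ k"
    unfolding inverse_density_power_mult[OF n_ge_1]
    using n_ge_1 inverse_max_k_density_le[OF unif pos] by (simp add: ge_one_powr_ge_zero)
  fix \<phi> J assume J_edges: "J \<subseteq> edges F" "J \<noteq> {}"
  have "real (codegree (embeddings F n) (\<lambda>\<phi> e. \<phi> ` e) J \<phi>) \<le> real (v ^ v) * real n ^ (v - card (\<Union>J))"
    using codegree_embeddings_le[OF unif J_edges(1), of n \<phi>] unfolding v_def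
    by (simp flip: of_nat_power of_nat_mult)
  also have "\<dots> \<le> real (v ^ v)
      * (real n ^ (v - k) * (real n powr (- 1 / max_k_density k F)) ^ (card J - 1))"
    unfolding v_def using power_spanned_le[OF unif pos n_ge_1 J_edges] by (rule mult_left_mono) simp
  finally show "real (codegree (embeddings F n) (\<lambda>\<phi> e. \<phi> ` e) J \<phi>) \<le> real (v ^ v) * real n ^ (v - k)
      * (real n powr (- 1 / max_k_density k F)) ^ (card J - 1)"
    by (simp only: mult.assoc)
qed (use n_ge_1 in \<open>auto simp: finite_verts[OF unif] finite_edges[OF unif] finite_embeddings
      finite_k_sets\<close>)

definition has_sparse_containers :: "nat \<Rightarrow> 'a hypergraph \<Rightarrow> nat \<Rightarrow> real \<Rightarrow> real \<Rightarrow> bool" where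
  "has_sparse_containers k F n \<epsilon> M \<longleftrightarrow> has_containers
     (\<lambda>I. I \<subseteq> k_sets k n \<and> embeddings_in F n I = {})
     (\<lambda>C. real (card (embeddings_in F n C)) < \<epsilon> * real n ^ card (verts F)) M"

lemma has_sparse_containers_mono:
  "has_sparse_containers k F n \<epsilon> M \<Longrightarrow> M \<le> M' \<Longrightarrow> has_sparse_containers k F n \<epsilon> M'"
  unfolding has_sparse_containers_def by (rule has_containers_mono)

lemma Suc_power_powr_le_exp:
  assumes "2 \<le> n" "0 \<le> a"
  shows "(real n ^ k + 1) powr a \<le> exp (real (k + 1) * a * ln (real n))"
proof -
  have "real n ^ k + 1 \<le> real n ^ k * 2" using assms(1) by simp
  also have "\<dots> \<le> real n ^ (k + 1)" using assms(1) by (simp add: mult.commute)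
  finally have "(real n ^ k + 1) powr a \<le> (real n ^ (k + 1)) powr a"
    using assms(2) by (intro powr_mono2) (auto intro: add_nonneg_nonneg)
  also have "real n ^ (k + 1) = exp (real (k + 1) * ln (real n))"
    using assms(1) by (simp only: exp_of_nat_mult) simp
  finally show ?thesis by (simp add: powr_def algebra_simps)
qed

lemma has_sparse_containers_of_gap:
  fixes \<epsilon> :: real
  assumes unif: "uniform_hypergraph k F" and pos: "0 < max_k_density k F" and \<epsilon>_pos: "0 < \<epsilon>"
    and n_ge_2: "2 \<le> n"
  defines "\<gamma> \<equiv> container_gap (card (edges F)) (\<epsilon> / real (card (verts F) ^ card (verts F)))"
  assumes gap: "real n powr (- 1 / max_k_density k F) \<le> \<gamma>"
  shows "has_sparse_containers k F n \<epsilon> (exp (real ((k + 1) * (nat \<lceil>1 / \<gamma>\<rceil> * card (edges F)))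
    * (real n powr (real k - 1 / max_k_density k F) * ln (real n))))"
proof -
  let ?v = "card (verts F)" and ?T = "nat \<lceil>1 / \<gamma>\<rceil> * card (edges F)"
  let ?growth = "real n powr (real k - 1 / max_k_density k F)"
  have nonempty: "edges F \<noteq> {}" using unif pos by (rule edges_nonempty)
  have k_le_v: "k \<le> ?v" using card_spanned[OF unif order_refl nonempty] by linarith
  then have v_pos: "0 < real (?v ^ ?v)" using uniformity_pos[OF unif pos] by simp
  interpret tuple_system "embeddings F n" "\<lambda>\<phi> e. \<phi> ` e" "edges F" "k_sets k n" "real n ^ k"
    "real (?v ^ ?v) * real n ^ (?v - k)" "real n powr (- 1 / max_k_density k F)"
    by (rule tuple_system_embeddings[OF unif pos]) (use n_ge_2 in simp)
  have growth: "real n powr (- 1 / max_k_density k F) * real n ^ k = ?growth"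
    using n_ge_2 by (intro inverse_density_power_mult) simp
  have count: "\<epsilon> / real (?v ^ ?v) * (real (?v ^ ?v) * real n ^ (?v - k)) * real n ^ k = \<epsilon> * real n ^ ?v"
    using v_pos k_le_v by (simp flip: power_add)
  have "has_sparse_containers k F n \<epsilon> ((real n ^ k + 1) powr (real ?T * ?growth))"
    using has_containers_sparse[OF nonempty divide_pos_pos[OF \<epsilon>_pos v_pos] gap[unfolded \<gamma>_def]]
    unfolding has_sparse_containers_def \<gamma>_def embeddings_in_eq_tuples_inside independent_def growth count
    by (rule has_containers_mono) auto
  then show ?thesis
    using Suc_power_powr_le_exp[OF n_ge_2, of "real ?T * ?growth" k]
    by (elim has_sparse_containers_mono) (simp add: algebra_simps)
qed

theorem hypergraph_containers:
  assumes unif: "uniform_hypergraph k F" and pos: "0 < max_k_density k F" and \<epsilon>_pos: "0 < \<epsilon>"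
  shows "\<exists>T::nat. \<forall>\<^sub>F n in sequentially. has_sparse_containers k F n \<epsilon>
    (exp (real T * (real n powr (real k - 1 / max_k_density k F) * ln (real n))))"
proof -
  let ?v = "card (verts F)"
  define \<gamma> where "\<gamma> = container_gap (card (edges F)) (\<epsilon> / real (?v ^ ?v))"
  have "0 < real (?v ^ ?v)" by (cases "?v = 0") auto
  then have "0 < \<gamma>" unfolding \<gamma>_def using \<epsilon>_pos by (intro container_gap_pos) simp
  moreover have "((\<lambda>n. real n powr (- 1 / max_k_density k F)) \<longlongrightarrow> 0) sequentially"
    using pos by (intro tendsto_neg_powr filterlim_real_sequentially) auto
  ultimately have "\<forall>\<^sub>F n in sequentially. real n powr (- 1 / max_k_density k F) < \<gamma>"
    by (rule order_tendstoD(2)[rotated])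
  then have "\<forall>\<^sub>F n in sequentially. has_sparse_containers k F n \<epsilon>
    (exp (real ((k + 1) * (nat \<lceil>1 / \<gamma>\<rceil> * card (edges F)))
      * (real n powr (real k - 1 / max_k_density k F) * ln (real n))))"
    using eventually_ge_at_top[of 2]
    by eventually_elim
      (unfold \<gamma>_def, intro has_sparse_containers_of_gap[OF unif pos \<epsilon>_pos], auto intro: less_imp_le)
  then show ?thesis by blast
qed

section \<open>The probability of containing no copy\<close>

definition expected_counts_ge :: "'a hypergraph \<Rightarrow> nat \<Rightarrow> real \<Rightarrow> real \<Rightarrow> bool" where
  "expected_counts_ge F n p L \<longleftrightarrow> (\<forall>J. J \<subseteq> edges F \<and> J \<noteq> {} \<longrightarrow> L \<le> real n ^ card (\<Union>J) * p ^ card J)"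

lemma inj_on_image_edges:
  assumes "uniform_hypergraph k F" "\<phi> \<in> embeddings F n"
  shows "inj_on (\<lambda>e. \<phi> ` e) (edges F)"
proof -
  have "inj_on \<phi> (verts F)" using assms(2) unfolding embeddings_def injections_def by simp
  then show ?thesis
    using edge_subset[OF assms(1)] by (intro inj_onI) (meson inj_on_image_eq_iff)
qed

lemma card_image_edges:
  assumes "uniform_hypergraph k F" "\<phi> \<in> embeddings F n"
  shows "card (image_edges F \<phi>) = card (edges F)"
  unfolding image_edges_def using inj_on_image_edges[OF assms] by (rule card_image)

lemma overlap_weight_image_edges_le:
  assumes unif: "uniform_hypergraph k F" and \<phi>_emb: "\<phi> \<in> embeddings F n"
    and \<psi>_emb: "\<psi> \<in> embeddings F n"
    and p_nonneg: "0 \<le> p"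
  defines "l \<equiv> card (edges F)"
  shows "overlap_weight p (image_edges F) \<phi> \<psi>
    \<le> (\<Sum>J | J \<subseteq> edges F \<and> J \<noteq> {}. if \<psi> ` \<Union>J \<subseteq> \<phi> ` verts F then p ^ (2 * l - card J) else 0)"
    (is "_ \<le> sum ?g ?Js")
proof (cases "image_edges F \<phi> \<inter> image_edges F \<psi> = {}")
  case True
  then show ?thesis using p_nonneg by (simp add: overlap_weight_def sum_nonneg)
next
  case False
  define J where "J = {e \<in> edges F. \<psi> ` e \<in> image_edges F \<phi>}"
  have meet: "image_edges F \<phi> \<inter> image_edges F \<psi> = (\<lambda>e. \<psi> ` e) ` J"
    unfolding J_def image_edges_def by blast
  have J_member: "J \<in> ?Js" using False meet unfolding J_def by auto
  have "card ((\<lambda>e. \<psi> ` e) ` J) = card J"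
    using inj_on_subset[OF inj_on_image_edges[OF unif \<psi>_emb]]
    by (intro card_image) (auto simp: J_def)
  moreover have "finite (image_edges F \<xi>)" for \<xi> :: "'a \<Rightarrow> nat"
    unfolding image_edges_def using finite_edges[OF unif] by simp
  then have "card (image_edges F \<phi>) + card (image_edges F \<psi>)
      = card (image_edges F \<phi> \<union> image_edges F \<psi>) + card (image_edges F \<phi> \<inter> image_edges F \<psi>)"
    by (intro card_Un_Int)
  ultimately have "card (image_edges F \<phi> \<union> image_edges F \<psi>) = 2 * l - card J"
    using meet card_image_edges[OF unif \<phi>_emb] card_image_edges[OF unif \<psi>_emb] unfolding l_def
    by simp
  moreover have "\<psi> ` \<Union>J \<subseteq> \<phi> ` verts F"
    unfolding J_def image_edges_def using edge_subset[OF unif] by blast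
  ultimately have "overlap_weight p (image_edges F) \<phi> \<psi> = ?g J"
    using False by (simp add: overlap_weight_def)
  also have "\<dots> \<le> sum ?g ?Js"
    using J_member finite_edges[OF unif] p_nonneg by (intro member_le_sum[of J ?Js ?g]) auto
  finally show ?thesis .
qed

lemma card_overlapping_embeddings_le:
  assumes unif: "uniform_hypergraph k F" and J_edges: "J \<subseteq> edges F" "J \<noteq> {}"
    and p_pos: "0 < p" and counts: "0 < L" "expected_counts_ge F n p L"
  defines "v \<equiv> card (verts F)" and "l \<equiv> card (edges F)"
  shows "real (card {\<psi> \<in> embeddings F n. \<psi> ` \<Union>J \<subseteq> \<phi> ` verts F}) * p ^ (2 * l - card J)
    \<le> real (v ^ v) * (real n ^ v * p ^ (2 * l) / L)"
proof -
  let ?w = "card (\<Union>J)"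
  have fin: "finite (verts F)" using unif by (rule finite_verts)
  have w_le_v: "?w \<le> v" using card_spanned_le[OF unif J_edges] unfolding v_def .
  have J_le_l: "card J \<le> l"
    unfolding l_def using J_edges(1) finite_edges[OF unif] by (intro card_mono)
  have "card {\<psi> \<in> embeddings F n. \<psi> ` \<Union>J \<subseteq> \<phi> ` verts F} \<le> v ^ v * n ^ (v - ?w)"
    unfolding v_def using fin J_edges(1) edge_subset[OF unif] card_image_le[OF fin, of \<phi>]
    by (intro card_embeddings_into_le) auto
  then have "real (card {\<psi> \<in> embeddings F n. \<psi> ` \<Union>J \<subseteq> \<phi> ` verts F}) \<le> real (v ^ v) * real n ^ (v - ?w)"
    by (simp flip: of_nat_power of_nat_mult)
  then have "real (card {\<psi> \<in> embeddings F n. \<psi> ` \<Union>J \<subseteq> \<phi> ` verts F}) * p ^ (2 * l - card J)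
      \<le> real (v ^ v) * real n ^ (v - ?w) * p ^ (2 * l - card J)"
    using p_pos by (intro mult_right_mono) auto
  also have "\<dots> = real (v ^ v) * (real n ^ (v - ?w) * p ^ (2 * l - card J))" by simp
  also have "\<dots> \<le> real (v ^ v) * (real n ^ v * p ^ (2 * l) / L)"
  proof (rule mult_left_mono)
    have "real n ^ (v - ?w) * p ^ (2 * l - card J) * L
        \<le> real n ^ (v - ?w) * p ^ (2 * l - card J) * (real n ^ ?w * p ^ card J)"
      using counts(2) J_edges p_pos unfolding expected_counts_ge_def by (intro mult_left_mono) auto
    also have "\<dots> = (real n ^ (v - ?w) * real n ^ ?w) * (p ^ (2 * l - card J) * p ^ card J)"
      by (simp add: mult_ac)
    also have "\<dots> = real n ^ v * p ^ (2 * l)" using w_le_v J_le_l by (simp flip: power_add)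
    finally show "real n ^ (v - ?w) * p ^ (2 * l - card J) \<le> real n ^ v * p ^ (2 * l) / L"
      using counts(1) by (simp add: pos_le_divide_eq)
  qed simp
  finally show ?thesis .
qed

lemma sum_overlap_weight_embeddings_le:
  assumes unif: "uniform_hypergraph k F" and p_pos: "0 < p"
    and counts: "0 < L" "expected_counts_ge F n p L"
    and \<phi>_emb: "\<phi> \<in> embeddings F n"
  defines "v \<equiv> card (verts F)" and "l \<equiv> card (edges F)"
  shows "(\<Sum>\<psi>\<in>embeddings F n. overlap_weight p (image_edges F) \<phi> \<psi>)
    \<le> 2 ^ l * (real (v ^ v) * (real n ^ v * p ^ (2 * l) / L))"
proof -
  let ?Js = "{J. J \<subseteq> edges F \<and> J \<noteq> {}}" and ?q = "\<lambda>J. p ^ (2 * l - card J)"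
    and ?bound = "real (v ^ v) * (real n ^ v * p ^ (2 * l) / L)"
  have fin: "finite (embeddings F n)" using unif by (intro finite_embeddings finite_verts)
  have "(\<Sum>\<psi>\<in>embeddings F n. overlap_weight p (image_edges F) \<phi> \<psi>)
      \<le> (\<Sum>\<psi>\<in>embeddings F n. \<Sum>J\<in>?Js. if \<psi> ` \<Union>J \<subseteq> \<phi> ` verts F then ?q J else 0)"
    unfolding l_def using p_pos
    by (intro sum_mono overlap_weight_image_edges_le[OF unif \<phi>_emb]) auto
  also have "\<dots> = (\<Sum>J\<in>?Js. \<Sum>\<psi>\<in>embeddings F n. if \<psi> ` \<Union>J \<subseteq> \<phi> ` verts F then ?q J else 0)"
    by (rule sum.swap)
  also have "\<dots> = (\<Sum>J\<in>?Js. real (card {\<psi> \<in> embeddings F n. \<psi> ` \<Union>J \<subseteq> \<phi> ` verts F}) * ?q J)"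
    using fin by (simp add: sum.If_cases Int_def)
  also have "\<dots> \<le> real (card ?Js) * ?bound"
    unfolding v_def l_def
    by (intro sum_bounded_above card_overlapping_embeddings_le[OF unif _ _ p_pos counts]) auto
  also have "\<dots> \<le> 2 ^ l * ?bound"
    using card_nonempty_subsets_le[OF finite_edges[OF unif]] p_pos counts(1)
    unfolding l_def by (intro mult_right_mono) (simp_all flip: of_nat_le_iff)
  finally show ?thesis .
qed

definition overlap_factor :: "'a hypergraph \<Rightarrow> real" where
  "overlap_factor F = 2 ^ card (edges F) * real (card (verts F) ^ card (verts F))"

lemma overlap_factor_ge_1: "1 \<le> overlap_factor F"
proof -
  have "1 \<le> real (card (verts F) ^ card (verts F))" by (cases "card (verts F) = 0") auto
  then have "1 * 1 \<le> overlap_factor F" unfolding overlap_factor_def by (intro mult_mono) auto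
  then show ?thesis by simp
qed

lemma off_diagonal_sum_embeddings_in_le:
  assumes unif: "uniform_hypergraph k F" and p_pos: "0 < p"
    and counts: "0 < L" "expected_counts_ge F n p L"
  defines "v \<equiv> card (verts F)" and "l \<equiv> card (edges F)"
  shows "off_diagonal_sum (overlap_weight p (image_edges F)) (embeddings_in F n K)
    \<le> overlap_factor F * (real n ^ v * p ^ l)\<^sup>2 / L"
proof -
  let ?\<Phi> = "embeddings_in F n K" and ?w = "overlap_weight p (image_edges F)"
    and ?bound = "2 ^ l * (real (v ^ v) * (real n ^ v * p ^ (2 * l) / L))"
  have fin: "finite (verts F)" using unif by (rule finite_verts)
  have "off_diagonal_sum ?w ?\<Phi> \<le> (\<Sum>\<phi>\<in>?\<Phi>. \<Sum>\<psi>\<in>embeddings F n. ?w \<phi> \<psi>)"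
    unfolding off_diagonal_sum_def
    using embeddings_in_subset[of F n K] finite_embeddings[OF fin, of n] p_pos
    by (intro sum_mono sum_mono2) (auto simp: overlap_weight_nonneg)
  also have "\<dots> \<le> real (card ?\<Phi>) * ?bound"
    unfolding v_def l_def
    by (intro sum_bounded_above sum_overlap_weight_embeddings_le[OF unif p_pos counts])
      (use embeddings_in_subset in blast)
  also have "\<dots> \<le> real n ^ v * ?bound"
    unfolding v_def using p_pos counts(1) by (intro mult_right_mono card_embeddings_in_le fin) auto
  also have "\<dots> = overlap_factor F * (real n ^ v * p ^ l)\<^sup>2 / L"
    unfolding overlap_factor_def v_def l_def
    by (simp add: power2_eq_square power_mult power_mult_distrib mult_ac)
  finally show ?thesis .
qed

lemma expected_counts_ge_imp_le:
  assumes unif: "uniform_hypergraph k F" and nonempty: "edges F \<noteq> {}" and n_ge_1: "1 \<le> n"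
    and p_nonneg: "0 \<le> p" and counts: "expected_counts_ge F n p L"
  shows "L \<le> real n ^ card (verts F) * p ^ card (edges F)"
proof -
  have "L \<le> real n ^ card (\<Union>(edges F)) * p ^ card (edges F)"
    using counts nonempty unfolding expected_counts_ge_def by blast
  also have "\<dots> \<le> real n ^ card (verts F) * p ^ card (edges F)"
    using n_ge_1 p_nonneg card_spanned_le[OF unif order_refl nonempty]
    by (intro mult_right_mono power_increasing) auto
  finally show ?thesis .
qed

theorem prob_no_embedding_le:
  assumes unif: "uniform_hypergraph k F" and nonempty: "edges F \<noteq> {}" and \<delta>_pos: "0 < \<delta>"
    and n_ge_1: "1 \<le> n" and p_bounds: "0 < p" "p \<le> 1"
    and counts: "0 < L" "expected_counts_ge F n p L"
    and many: "\<delta> * real n ^ card (verts F) \<le> real (card (embeddings_in F n K))"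
  shows "measure_pmf.prob (random_subset (k_sets k n) p)
      (avoiding (image_edges F) (embeddings_in F n K))
    \<le> exp (- (\<delta>\<^sup>2 / (4 * overlap_factor F) * L))"
proof -
  interpret bernoulli_product "k_sets k n" p
    using p_bounds finite_k_sets by unfold_locales auto
  let ?v = "card (verts F)" and ?l = "card (edges F)" and ?\<Phi> = "embeddings_in F n K"
    and ?b = "overlap_factor F"
  define y where "y = real n ^ ?v * p ^ ?l"
  have y_pos: "0 < y" unfolding y_def using n_ge_1 p_bounds by simp
  have "\<delta> * real n ^ ?v \<le> 1 * real n ^ ?v"
    using many card_embeddings_in_le[OF finite_verts[OF unif], of n K] by linarith
  then have \<delta>_le_1: "\<delta> \<le> 1" using n_ge_1 by simp
  have L_le_y: "L \<le> y"
    unfolding y_def using expected_counts_ge_imp_le[OF unif nonempty n_ge_1 _ counts(2)] p_bounds(1)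
    by simp
  have "prob (avoiding (image_edges F) ?\<Phi>) \<le> exp (- ((\<delta> * y)\<^sup>2 / (4 * (?b * y\<^sup>2 / L))))"
  proof (rule janson_inequality)
    show "finite ?\<Phi>" using unif by (intro finite_embeddings_in finite_verts)
    show "image_edges F \<phi> \<subseteq> k_sets k n" if "\<phi> \<in> ?\<Phi>" for \<phi>
      using image_edges_subset_k_sets[OF unif] that embeddings_in_subset by blast
    have "card (image_edges F \<phi>) = ?l" if "\<phi> \<in> ?\<Phi>" for \<phi>
      using card_image_edges[OF unif] that embeddings_in_subset by blast
    then show "\<delta> * y \<le> (\<Sum>\<phi>\<in>?\<Phi>. p ^ card (image_edges F \<phi>))"
      unfolding y_def using mult_right_mono[OF many, of "p ^ ?l"] p_bounds by (simp add: mult.assoc)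
    show "off_diagonal_sum (overlap_weight p (image_edges F)) ?\<Phi> \<le> ?b * y\<^sup>2 / L"
      unfolding y_def using off_diagonal_sum_embeddings_in_le[OF unif p_bounds(1) counts] .
    have "(\<delta> * y) * L \<le> (2 * ?b * y) * y"
      using \<delta>_le_1 overlap_factor_ge_1[of F] y_pos counts L_le_y by (intro mult_mono) (auto simp: mult_right_mono)
    then show "\<delta> * y \<le> 2 * (?b * y\<^sup>2 / L)"
      using counts(1) overlap_factor_ge_1[of F] y_pos by (simp add: pos_le_divide_eq power2_eq_square mult_ac)
  qed (use \<delta>_pos overlap_factor_ge_1[of F] y_pos counts in auto)
  also have "(\<delta> * y)\<^sup>2 / (4 * (?b * y\<^sup>2 / L)) = \<delta>\<^sup>2 / (4 * ?b) * L"
    using y_pos by (simp add: power_mult_distrib)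
  finally show ?thesis .
qed

section \<open>The random Ramsey theorem\<close>

lemma embedding_in_copy:
  assumes unif: "uniform_hypergraph k F" and \<phi>_emb: "\<phi> \<in> embeddings_in F n K"
  shows "subhypergraph (Hypergraph (\<phi> ` verts F) (image_edges F \<phi>)) (Hypergraph {1..n} K)"
    and "isomorphic F (Hypergraph (\<phi> ` verts F) (image_edges F \<phi>))"
proof -
  have \<phi>_inj: "\<phi> ` verts F \<subseteq> {1..n}" "inj_on \<phi> (verts F)" "image_edges F \<phi> \<subseteq> K"
    using \<phi>_emb unfolding embeddings_in_def embeddings_def injections_def by auto
  then show "isomorphic F (Hypergraph (\<phi> ` verts F) (image_edges F \<phi>))"
    unfolding isomorphic_def image_edges_def by (intro exI[of _ \<phi>]) (simp add: bij_betw_def)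
  have "d \<subseteq> \<phi> ` verts F" if "d \<in> image_edges F \<phi>" for d
    using that edge_subset[OF unif] unfolding image_edges_def by blast
  then show "subhypergraph (Hypergraph (\<phi> ` verts F) (image_edges F \<phi>)) (Hypergraph {1..n} K)"
    using \<phi>_inj unfolding subhypergraph_def by simp
qed

lemma not_arrows_obtain_free_classes:
  fixes F :: "nat \<Rightarrow> 'a hypergraph"
  assumes "\<And>i. i \<in> {1..r} \<Longrightarrow> uniform_hypergraph k (F i)" "\<not> arrows (Hypergraph {1..n} K) r F"
  obtains I where "K = (\<Union>i\<in>{1..r}. I i)" "\<And>i. i \<in> {1..r} \<Longrightarrow> embeddings_in (F i) n (I i) = {}"
proof -
  obtain col where col: "\<And>e. e \<in> K \<Longrightarrow> col e \<in> {1..r}"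
    and no_copy: "\<And>i H. i \<in> {1..r} \<Longrightarrow> subhypergraph H (Hypergraph {1..n} K)
      \<Longrightarrow> isomorphic (F i) H \<Longrightarrow> \<exists>e\<in>edges H. col e \<noteq> i"
    using assms(2) unfolding arrows_def hypergraph.sel by blast
  define I where "I i = {e\<in>K. col e = i}" for i
  show ?thesis
  proof (rule that)
    show "K = (\<Union>i\<in>{1..r}. I i)" unfolding I_def using col by blast
    show "embeddings_in (F i) n (I i) = {}" if i_range: "i \<in> {1..r}" for i
    proof (rule ccontr)
      assume "embeddings_in (F i) n (I i) \<noteq> {}"
      then obtain \<phi> where "\<phi> \<in> embeddings_in (F i) n (I i)" by blast
      then have sub: "\<phi> \<in> embeddings_in (F i) n K" "image_edges (F i) \<phi> \<subseteq> I i"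
        unfolding embeddings_in_def I_def by auto
      note copy = embedding_in_copy[OF assms(1)[OF i_range] sub(1)]
      show False using no_copy[OF i_range copy] sub(2) unfolding I_def by auto
    qed
  qed
qed

lemma prob_binomial_hypergraph:
  "measure_pmf.prob (binomial_hypergraph k n p) S
    = measure_pmf.prob (random_subset (k_sets k n) p) {X. Hypergraph {1..n} {e\<in>k_sets k n. X e} \<in> S}"
  unfolding binomial_hypergraph_def random_subset_def by (simp add: vimage_def)

lemma not_arrows_imp_avoiding:
  fixes F :: "nat \<Rightarrow> 'a hypergraph"
  assumes "1 \<le> r" and unif: "\<And>i. i \<in> {1..r} \<Longrightarrow> uniform_hypergraph k (F i)"
    and "\<not> arrows (Hypergraph {1..n} {e\<in>K. X e}) r F"
    and covers: "\<And>I. (\<And>i. i \<in> {2..r} \<Longrightarrow> I i \<subseteq> K \<and> embeddings_in (F i) n (I i) = {}) \<Longrightarrow>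
      \<exists>C\<in>\<C>. (\<Union>i\<in>{2..r}. I i) \<subseteq> C"
  shows "\<exists>C\<in>\<C>. X \<in> avoiding (image_edges (F 1)) (embeddings_in (F 1) n (K - C))"
proof -
  obtain I where classes: "{e\<in>K. X e} = (\<Union>i\<in>{1..r}. I i)"
    "\<And>i. i \<in> {1..r} \<Longrightarrow> embeddings_in (F i) n (I i) = {}"
    by (rule not_arrows_obtain_free_classes[OF unif assms(3)]) (assumption, rule that)
  have "I i \<subseteq> K \<and> embeddings_in (F i) n (I i) = {}" if "i \<in> {2..r}" for i
  proof -
    have i_range: "i \<in> {1..r}" using that by simp
    then have "I i \<subseteq> {e\<in>K. X e}" unfolding classes(1) by blast
    then show ?thesis using classes(2)[OF i_range] by blast
  qed
  then obtain C where container: "C \<in> \<C>" "(\<Union>i\<in>{2..r}. I i) \<subseteq> C" using covers by blast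
  have "X \<notin> present (image_edges (F 1) \<phi>)" if \<phi>_emb: "\<phi> \<in> embeddings_in (F 1) n (K - C)" for \<phi>
  proof
    assume "X \<in> present (image_edges (F 1) \<phi>)"
    then have "image_edges (F 1) \<phi> \<subseteq> {e\<in>K. X e} - (\<Union>i\<in>{2..r}. I i)"
      using \<phi>_emb container(2) unfolding embeddings_in_def present_def by blast
    also have "\<dots> \<subseteq> I 1"
    proof -
      have "{1..r} = insert 1 {2..r}" using assms(1) by auto
      then show ?thesis unfolding classes(1) by auto
    qed
    finally have "\<phi> \<in> embeddings_in (F 1) n (I 1)" using \<phi>_emb unfolding embeddings_in_def by simp
    then show False using classes(2)[of 1] assms(1) by simp
  qed
  then show ?thesis using container(1) unfolding avoiding_def by blast
qed

lemma prob_not_arrows_le: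
  fixes F :: "nat \<Rightarrow> 'a hypergraph"
  assumes "1 \<le> r" and unif: "\<And>i. i \<in> {1..r} \<Longrightarrow> uniform_hypergraph k (F i)"
    and containers: "\<And>i. i \<in> {2..r} \<Longrightarrow> has_sparse_containers k (F i) n \<delta> (M i)"
    and avoid: "\<And>D. (\<And>i. i \<in> {2..r} \<Longrightarrow>
        real (card (embeddings_in (F i) n (D i))) < \<delta> * real n ^ card (verts (F i))) \<Longrightarrow>
      measure_pmf.prob (random_subset (k_sets k n) p) (avoiding (image_edges (F 1))
        (embeddings_in (F 1) n (k_sets k n - (\<Union>i\<in>{2..r}. D i)))) \<le> \<beta>"
    and "0 \<le> \<beta>"
  shows "measure_pmf.prob (binomial_hypergraph k n p) {G. \<not> arrows G r F} \<le> (\<Prod>i\<in>{2..r}. M i) * \<beta>"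
proof -
  let ?P = "measure_pmf.prob (random_subset (k_sets k n) p)"
    and ?avoiding = "\<lambda>C. avoiding (image_edges (F 1)) (embeddings_in (F 1) n (k_sets k n - C))"
    and ?bad = "{X. \<not> arrows (Hypergraph {1..n} {e\<in>k_sets k n. X e}) r F}"
  obtain \<C> where family: "finite \<C>" "real (card \<C>) \<le> (\<Prod>i\<in>{2..r}. M i)"
    and sparse: "\<And>C. C \<in> \<C> \<Longrightarrow> \<exists>D. (\<forall>i\<in>{2..r}.
        real (card (embeddings_in (F i) n (D i))) < \<delta> * real n ^ card (verts (F i)))
      \<and> C = (\<Union>i\<in>{2..r}. D i)"
    and covers: "\<And>J. \<exists>I. (\<forall>i\<in>{2..r}. I i \<subseteq> k_sets k n \<and> embeddings_in (F i) n (I i) = {})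
      \<and> J = (\<Union>i\<in>{2..r}. I i) \<Longrightarrow> \<exists>C\<in>\<C>. J \<subseteq> C"
    by (rule has_containersE[OF has_containers_UN[OF finite_atLeastAtMost
            containers[unfolded has_sparse_containers_def]]]) (assumption, rule that)
  have "?bad \<subseteq> (\<Union>C\<in>\<C>. ?avoiding C)"
  proof
    fix X assume "X \<in> ?bad"
    moreover have "\<exists>C\<in>\<C>. (\<Union>i\<in>{2..r}. I i) \<subseteq> C"
      if "\<And>i. i \<in> {2..r} \<Longrightarrow> I i \<subseteq> k_sets k n \<and> embeddings_in (F i) n (I i) = {}" for I
      using that by (intro covers exI[of _ I] conjI ballI refl) auto
    ultimately have "\<exists>C\<in>\<C>. X \<in> ?avoiding C"
      by (intro not_arrows_imp_avoiding[OF assms(1) unif]) simp_all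
    then show "X \<in> (\<Union>C\<in>\<C>. ?avoiding C)" by blast
  qed
  then have "?P ?bad \<le> ?P (\<Union>C\<in>\<C>. ?avoiding C)"
    by (intro measure_pmf.finite_measure_mono) auto
  also have "\<dots> \<le> (\<Sum>C\<in>\<C>. ?P (?avoiding C))"
    using family(1) by (intro measure_pmf.finite_measure_subadditive_finite) auto
  also have "\<dots> \<le> real (card \<C>) * \<beta>"
    using sparse avoid by (intro sum_bounded_above) metis
  also have "\<dots> \<le> (\<Prod>i\<in>{2..r}. M i) * \<beta>" using family(2) assms(5) by (rule mult_right_mono)
  finally show ?thesis by (simp add: prob_binomial_hypergraph)
qed

lemma card_embeddings_outside_ge:
  fixes F :: "nat \<Rightarrow> 'a hypergraph"
  assumes "1 \<le> r" and saturated: "ramsey_supersaturated k r F n \<delta>"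
    and sparse: "\<And>i. i \<in> {2..r} \<Longrightarrow>
      real (card (embeddings_in (F i) n (D i))) < \<delta> * real n ^ card (verts (F i))"
  shows "\<delta> * real n ^ card (verts (F 1))
    \<le> real (card (embeddings_in (F 1) n (k_sets k n - (\<Union>i\<in>{2..r}. D i))))"
proof -
  let ?D = "D(1 := k_sets k n - (\<Union>i\<in>{2..r}. D i))"
  have split: "{1..r} = insert 1 {2..r}" using assms(1) by auto
  then have "k_sets k n \<subseteq> (\<Union>i\<in>{1..r}. ?D i)" by auto
  then obtain i where saturated_class: "i \<in> {1..r}"
    "\<delta> * real n ^ card (verts (F i)) \<le> real (card (embeddings_in (F i) n (?D i)))"
    using saturated unfolding ramsey_supersaturated_def by blast
  have "i = 1"
  proof (rule ccontr)
    assume "i \<noteq> 1"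
    then have "i \<in> {2..r}" using saturated_class(1) split by auto
    then show False using saturated_class(2) sparse[of i] \<open>i \<noteq> 1\<close> by simp
  qed
  then show ?thesis using saturated_class(2) by simp
qed

lemma threshold_expected_counts_ge:
  fixes F1 F2 :: "'a hypergraph"
  assumes unif: "uniform_hypergraph k F1" and pos: "0 < max_k_density k F2" and n_ge_3: "3 \<le> n"
    and C_ge_1: "1 \<le> C"
    and p_ge: "C * real n powr (- 1 / asym_k_density k F1 F2) * ln (real n) \<le> p"
  shows "expected_counts_ge F1 n p (C * (real n powr (real k - 1 / max_k_density k F2) * ln (real n)))"
  unfolding expected_counts_ge_def
proof (intro allI impI)
  fix J assume "J \<subseteq> edges F1 \<and> J \<noteq> {}"
  then have J_edges: "J \<subseteq> edges F1" "J \<noteq> {}" by auto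
  let ?a = "asym_k_density k F1 F2" and ?m = "max_k_density k F2" and ?w = "card (\<Union>J)"
  have "exp 1 \<le> real n" using exp_le n_ge_3 by (meson numeral_le_real_of_nat_iff order_trans)
  then have ln_ge_1: "1 \<le> ln (real n)" using n_ge_3 by (simp add: ln_ge_iff)
  have Cln_ge_1: "1 \<le> C * ln (real n)"
    using mult_mono[of 1 C 1 "ln (real n)"] C_ge_1 ln_ge_1 by simp
  have "C * (real n powr (real k - 1 / ?m) * ln (real n))
      = C * ln (real n) * real n powr (real k - 1 / ?m)" by simp
  also have "\<dots> \<le> (C * ln (real n)) ^ card J * real n powr (real ?w - real (card J) / ?a)"
  proof (rule mult_mono)
    show "C * ln (real n) \<le> (C * ln (real n)) ^ card J"
      using power_increasing[OF card_edges_pos[OF unif J_edges] Cln_ge_1] by simp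
    show "real n powr (real k - 1 / ?m) \<le> real n powr (real ?w - real (card J) / ?a)"
      using card_edges_le_asym_k_density[OF unif pos J_edges] n_ge_3 by (intro powr_mono) auto
  qed (use Cln_ge_1 in auto)
  also have "\<dots> = real n ^ ?w * (C * real n powr (- 1 / ?a) * ln (real n)) ^ card J"
  proof -
    have "real n powr (real ?w - real (card J) / ?a) = real n ^ ?w * (real n powr (- 1 / ?a)) ^ card J"
      using n_ge_3 by (simp add: powr_realpow[symmetric] powr_powr flip: powr_add)
    then show ?thesis by (simp add: power_mult_distrib mult_ac)
  qed
  also have "\<dots> \<le> real n ^ ?w * p ^ card J"
    using p_ge C_ge_1 ln_ge_1 by (intro mult_left_mono power_mono) auto
  finally show "C * (real n powr (real k - 1 / ?m) * ln (real n)) \<le> real n ^ ?w * p ^ card J" .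
qed

locale ramsey_targets =
  fixes k r :: nat and F :: "nat \<Rightarrow> 'a hypergraph"
  assumes two_le_r: "2 \<le> r"
    and uniform: "i \<in> {1..r} \<Longrightarrow> uniform_hypergraph k (F i)"
    and densities_decreasing: "i \<in> {1..<r} \<Longrightarrow> max_k_density k (F (Suc i)) \<le> max_k_density k (F i)"
    and last_density_pos: "0 < max_k_density k (F r)"
begin

definition container_growth :: "nat \<Rightarrow> real" where
  "container_growth n = real n powr (real k - 1 / max_k_density k (F 2)) * ln (real n)"

lemma density_antimono:
  assumes "1 \<le> i" "i \<le> j" "j \<le> r"
  shows "max_k_density k (F j) \<le> max_k_density k (F i)"
  using assms(2,3)
proof (induction j rule: dec_induct)
  case (step j)
  then show ?case using densities_decreasing[of j] assms(1) by simp
qed simp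

lemma density_pos: "i \<in> {1..r} \<Longrightarrow> 0 < max_k_density k (F i)"
  using density_antimono[of i r] last_density_pos by auto

lemma ln_le_container_growth:
  assumes "1 \<le> n"
  shows "ln (real n) \<le> container_growth n"
proof -
  have "1 / max_k_density k (F 2) \<le> real k"
    using inverse_max_k_density_le[OF uniform[of 2] density_pos[of 2]] two_le_r by simp
  then have "1 \<le> real n powr (real k - 1 / max_k_density k (F 2))"
    using assms by (simp add: ge_one_powr_ge_zero)
  then have "1 * ln (real n) \<le> container_growth n"
    unfolding container_growth_def using assms by (intro mult_right_mono) auto
  then show ?thesis by simp
qed

lemma eventually_has_sparse_containers:
  assumes "0 < \<delta>"
  obtains T :: "nat \<Rightarrow> nat" where "\<forall>\<^sub>F n in sequentially. \<forall>i\<in>{2..r}.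
    has_sparse_containers k (F i) n \<delta> (exp (real (T i) * container_growth n))"
proof -
  have "\<exists>T::nat. \<forall>\<^sub>F n in sequentially.
      has_sparse_containers k (F i) n \<delta> (exp (real T * container_growth n))"
    if i_range: "i \<in> {2..r}" for i
  proof -
    have exponent: "real k - 1 / max_k_density k (F i) \<le> real k - 1 / max_k_density k (F 2)"
      using density_antimono[of 2 i] density_pos[of i] i_range by (simp add: frac_le)
    obtain T :: nat where "\<forall>\<^sub>F n in sequentially. has_sparse_containers k (F i) n \<delta>
        (exp (real T * (real n powr (real k - 1 / max_k_density k (F i)) * ln (real n))))"
      using hypergraph_containers[OF uniform[of i] density_pos[of i] assms] i_range by auto
    then have "\<forall>\<^sub>F n in sequentially.
        has_sparse_containers k (F i) n \<delta> (exp (real T * container_growth n))"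
      using eventually_ge_at_top[of 1]
    proof eventually_elim
      case (elim n)
      then have "real T * (real n powr (real k - 1 / max_k_density k (F i)) * ln (real n))
          \<le> real T * container_growth n"
        unfolding container_growth_def using exponent
        by (intro mult_left_mono mult_right_mono powr_mono) auto
      then show ?case by (intro has_sparse_containers_mono[OF elim(1)]) simp
    qed
    then show ?thesis by blast
  qed
  then have "\<forall>i\<in>{2..r}. \<exists>T::nat. \<forall>\<^sub>F n in sequentially.
      has_sparse_containers k (F i) n \<delta> (exp (real T * container_growth n))"
    by blast
  from bchoice[OF this] obtain T :: "nat \<Rightarrow> nat" where "\<forall>i\<in>{2..r}. \<forall>\<^sub>F n in sequentially.
      has_sparse_containers k (F i) n \<delta> (exp (real (T i) * container_growth n))"
    by blast
  then show ?thesis by (intro that eventually_ball_finite) auto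
qed

lemma prob_not_arrows_le_exp:
  fixes T :: "nat \<Rightarrow> nat" and \<delta> C p :: real
  assumes "3 \<le> n" "0 < \<delta>" "1 \<le> C" "p \<le> 1"
    and threshold: "C * real n powr (- 1 / asym_k_density k (F 1) (F 2)) * ln (real n) \<le> p"
    and saturated: "ramsey_supersaturated k r F n \<delta>"
    and containers: "\<And>i. i \<in> {2..r} \<Longrightarrow>
      has_sparse_containers k (F i) n \<delta> (exp (real (T i) * container_growth n))"
  shows "measure_pmf.prob (binomial_hypergraph k n p) {G. \<not> arrows G r F}
    \<le> exp ((real (\<Sum>i\<in>{2..r}. T i) - \<delta>\<^sup>2 / (4 * overlap_factor (F 1)) * C) * container_growth n)"
proof -
  let ?h = "container_growth n" and ?rate = "\<delta>\<^sup>2 / (4 * overlap_factor (F 1))"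
  have in_range: "1 \<in> {1..r}" "2 \<in> {1..r}" using two_le_r by auto
  have "0 < ln (real n)" using assms(1) by simp
  also have "\<dots> \<le> ?h" using assms(1) by (intro ln_le_container_growth) simp
  finally have growth_pos: "0 < ?h" .
  have "0 < C * real n powr (- 1 / asym_k_density k (F 1) (F 2)) * ln (real n)"
    using assms(1,3) by simp
  then have p_pos: "0 < p" using threshold by linarith
  have counts: "expected_counts_ge (F 1) n p (C * ?h)"
    unfolding container_growth_def using assms(1,3) threshold
    by (intro threshold_expected_counts_ge uniform density_pos in_range)
  have "measure_pmf.prob (binomial_hypergraph k n p) {G. \<not> arrows G r F}
      \<le> (\<Prod>i\<in>{2..r}. exp (real (T i) * ?h)) * exp (- (?rate * (C * ?h)))"
  proof (rule prob_not_arrows_le[OF _ uniform containers])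
    fix D
    assume "\<And>i. i \<in> {2..r} \<Longrightarrow>
      real (card (embeddings_in (F i) n (D i))) < \<delta> * real n ^ card (verts (F i))"
    then have "\<delta> * real n ^ card (verts (F 1))
        \<le> real (card (embeddings_in (F 1) n (k_sets k n - (\<Union>i\<in>{2..r}. D i))))"
      using saturated two_le_r by (intro card_embeddings_outside_ge) auto
    then show "measure_pmf.prob (random_subset (k_sets k n) p) (avoiding (image_edges (F 1))
        (embeddings_in (F 1) n (k_sets k n - (\<Union>i\<in>{2..r}. D i)))) \<le> exp (- (?rate * (C * ?h)))"
      using assms(1-4) p_pos growth_pos counts
      by (intro prob_no_embedding_le uniform edges_nonempty[OF uniform density_pos] in_range) auto
  qed (use two_le_r in auto)
  also have "(\<Prod>i\<in>{2..r}. exp (real (T i) * ?h)) = exp (real (\<Sum>i\<in>{2..r}. T i) * ?h)"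
    by (simp add: exp_sum sum_distrib_right)
  finally show ?thesis by (simp add: algebra_simps flip: exp_add)
qed

theorem eventually_prob_not_arrows_le:
  "\<exists>C>0. \<forall>\<^sub>F n in sequentially. \<forall>p. 0 \<le> p \<and> p \<le> 1 \<longrightarrow>
    C * real n powr (- 1 / asym_k_density k (F 1) (F 2)) * ln (real n) \<le> p \<longrightarrow>
    measure_pmf.prob (binomial_hypergraph k n p) {G. \<not> arrows G r F} \<le> 1 / real n"
proof -
  obtain \<delta> where \<delta>_pos: "0 < \<delta>"
    and saturated: "\<forall>\<^sub>F n in sequentially. ramsey_supersaturated k r F n \<delta>"
    by (rule ramsey_supersaturation[OF uniform]) (assumption, rule that)
  obtain T :: "nat \<Rightarrow> nat" where containers: "\<forall>\<^sub>F n in sequentially. \<forall>i\<in>{2..r}.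
      has_sparse_containers k (F i) n \<delta> (exp (real (T i) * container_growth n))"
    using eventually_has_sparse_containers[OF \<delta>_pos] by blast
  define t where "t = real (\<Sum>i\<in>{2..r}. T i)"
  define c where "c = \<delta>\<^sup>2 / (4 * overlap_factor (F 1))"
  define C where "C = max 1 ((t + 1) / c)"
  have "0 < overlap_factor (F 1)" using overlap_factor_ge_1[of "F 1"] by linarith
  then have c_pos: "0 < c" unfolding c_def using \<delta>_pos by simp
  have C_bounds: "1 \<le> C" "(t + 1) / c \<le> C" unfolding C_def by simp_all
  then have exponent_le: "t - c * C \<le> - 1" using c_pos by (simp add: pos_divide_le_eq mult.commute)
  have "\<forall>\<^sub>F n in sequentially. \<forall>p. 0 \<le> p \<and> p \<le> 1 \<longrightarrow>
    C * real n powr (- 1 / asym_k_density k (F 1) (F 2)) * ln (real n) \<le> p \<longrightarrow>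
    measure_pmf.prob (binomial_hypergraph k n p) {G. \<not> arrows G r F} \<le> 1 / real n"
    using saturated containers eventually_ge_at_top[of 3]
  proof eventually_elim
    case (elim n)
    have ln_bounds: "0 < ln (real n)" "ln (real n) \<le> container_growth n"
      using elim(3) ln_le_container_growth[of n] by simp_all
    have "(t - c * C) * container_growth n \<le> - 1 * container_growth n"
      using exponent_le ln_bounds by (intro mult_right_mono) auto
    then have "exp ((t - c * C) * container_growth n) \<le> exp (- ln (real n))"
      using ln_bounds(2) by simp
    also have "\<dots> = 1 / real n" using elim(3) by (simp add: exp_minus divide_inverse)
    finally have "exp ((t - c * C) * container_growth n) \<le> 1 / real n" .
    moreover have "measure_pmf.prob (binomial_hypergraph k n p) {G. \<not> arrows G r F}
        \<le> exp ((t - c * C) * container_growth n)"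
      if "p \<le> 1" "C * real n powr (- 1 / asym_k_density k (F 1) (F 2)) * ln (real n) \<le> p" for p
      unfolding t_def c_def using elim that \<delta>_pos C_bounds(1) by (intro prob_not_arrows_le_exp) auto
    ultimately show ?case by (meson order_trans)
  qed
  moreover have "0 < C" using C_bounds(1) by simp
  ultimately show ?thesis by blast
qed

end

theorem theorem6p1:
  fixes k r :: nat and F :: "nat \<Rightarrow> 'a hypergraph"
  assumes "r \<ge> 2"
    and "\<And>i. i \<in> {1..r} \<Longrightarrow> uniform_hypergraph k (F i)"
    and "\<And>i. i \<in> {1..<r} \<Longrightarrow> max_k_density k (F i) \<ge> max_k_density k (F (Suc i))"
    and "max_k_density k (F r) > 0"
  shows "\<exists>C>0. \<forall>p :: nat \<Rightarrow> real.
           (\<forall>n. 0 \<le> p n \<and> p n \<le> 1) \<longrightarrow>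
           (\<forall>\<^sub>F n in sequentially.
              p n \<ge> C * real n powr (- 1 / asym_k_density k (F 1) (F 2)) * ln (real n)) \<longrightarrow>
           (\<lambda>n. measure_pmf.prob (binomial_hypergraph k n (p n)) {G. arrows G r F})
             \<longlonglongrightarrow> 1"
proof -
  interpret ramsey_targets k r F using assms by unfold_locales
  obtain C where C_pos: "0 < C" and fail: "\<forall>\<^sub>F n in sequentially. \<forall>p. 0 \<le> p \<and> p \<le> 1 \<longrightarrow>
    C * real n powr (- 1 / asym_k_density k (F 1) (F 2)) * ln (real n) \<le> p \<longrightarrow>
    measure_pmf.prob (binomial_hypergraph k n p) {G. \<not> arrows G r F} \<le> 1 / real n"
    using eventually_prob_not_arrows_le by blast
  have "(\<lambda>n. measure_pmf.prob (binomial_hypergraph k n (p n)) {G. arrows G r F}) \<longlonglongrightarrow> 1"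
    if p_range: "\<forall>n. 0 \<le> p n \<and> p n \<le> 1" and threshold: "\<forall>\<^sub>F n in sequentially.
      p n \<ge> C * real n powr (- 1 / asym_k_density k (F 1) (F 2)) * ln (real n)"
    for p :: "nat \<Rightarrow> real"
  proof (rule tendsto_sandwich[OF _ always_eventually _ tendsto_const])
    let ?prob = "\<lambda>n. measure_pmf.prob (binomial_hypergraph k n (p n))"
    have compl: "?prob n {G. arrows G r F} = 1 - ?prob n {G. \<not> arrows G r F}" for n
      using measure_pmf.prob_compl[of "{G. arrows G r F}" "binomial_hypergraph k n (p n)"]
      by (simp add: Compl_eq_Diff_UNIV[symmetric] Collect_neg_eq[symmetric])
    show "\<forall>\<^sub>F n in sequentially. 1 - 1 / real n \<le> ?prob n {G. arrows G r F}"
      unfolding compl using fail threshold by eventually_elim (use p_range in simp)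
    show "(\<lambda>n. 1 - 1 / real n) \<longlonglongrightarrow> 1"
      using tendsto_diff[OF tendsto_const[of 1] lim_1_over_n] by simp
  qed (simp add: measure_pmf.prob_le_1)
  then show ?thesis using C_pos by blast
qed

end
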